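(* Let $k\ge3$. Then $V_L^+=M(1)^++V_L^+(1)+C_2(V_L^+)$; that is, $V_L^+/C_2(V_L^+)$ is spanned by the images of $M(1)^+$ and $V_L^+(1)$.
   Context: $L=\mathbb{Z}\alpha$, $\langle\alpha,\alpha\rangle=2k$; $V_L=M(1)\otimes\mathbb{C}[L]$ the lattice VOA, $V_L^+$ the fixed points of the involution $\theta$ lifted from $-1$ on $L$, $M(1)^{\pm}$ the $\pm1$-eigenspaces of $\theta$ on $M(1)$, and $V_L^+(1)=M(1)^+\otimes(e^{\alpha}+e^{-\alpha})\oplus M(1)^-\otimes(e^{\alpha}-e^{-\alpha})$. $C_2(V)$ is the span of $\{v_{-2}u:u,v\in V\}$. *)

theory Defs
  imports Complex_Main "HOL-Library.Multiset"
begin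

text \<open>
Concrete model of the rank one lattice VOA V_L, L = Z alpha, (alpha,alpha) = 2k.
A basis vector is a pair (lam, m) with lam a multiset of naturals and m an integer;
it stands for the monomial  prod over j in lam of h(-(j+1))  tensor  e^(m alpha),
where h = alpha.  Vectors are functions from basis vectors to complex numbers;
V_L consists of the finitely supported ones.  The 2-cocycle is trivial
(admissible since the lattice has rank one and is even).
\<close>

type_synonym basis = "nat multiset \<times> int"
type_synonym vec = "basis \<Rightarrow> complex"

definition VL :: "vec set" where
  "VL = {f. finite {x. f x \<noteq> 0}}"

text \<open>weight of the partition lam (part j has degree j+1)\<close>
definition wt :: "nat multiset \<Rightarrow> nat" where
  "wt mu = size mu + sum_mset mu"

text \<open>Heisenberg operator alpha(n), [alpha(m),alpha(n)] = 2k m delta_{m+n,0},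
  alpha(0) acts on e^(m alpha) by 2km.\<close>
definition hop :: "nat \<Rightarrow> int \<Rightarrow> vec \<Rightarrow> vec" where
  "hop k n f = (\<lambda>(lam, m).
     if n < 0 then (if nat (-n-1) \<in># lam then f (lam - {#nat (-n-1)#}, m) else 0)
     else if n = 0 then 2 * of_nat k * of_int m * f (lam, m)
     else of_int n * 2 * of_nat k * of_nat (count lam (nat n - 1) + 1)
            * f (lam + {#nat n - 1#}, m))"

text \<open>multiplication by e^(b alpha) (trivial cocycle)\<close>
definition shiftL :: "int \<Rightarrow> vec \<Rightarrow> vec" where
  "shiftL b f = (\<lambda>(lam, m). f (lam, m - b))"

text \<open>coefficient of z^N in E^-(-b alpha, z) = exp (sum_{n>0} b alpha(-n) z^n / n)\<close>
definition Em :: "int \<Rightarrow> nat \<Rightarrow> vec \<Rightarrow> vec" where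
  "Em b N f = (\<lambda>(lam, m).
     \<Sum>mu\<in>{mu. mu \<subseteq># lam \<and> wt mu = N}.
       (\<Prod>j\<in>set_mset mu. (of_int b / of_nat (j+1)) ^ count mu j / fact (count mu j))
       * f (lam - mu, m))"

text \<open>coefficient of z^(-M) in E^+(-b alpha, z) = exp (- sum_{n>0} b alpha(n) z^(-n) / n)\<close>
definition Ep :: "nat \<Rightarrow> int \<Rightarrow> nat \<Rightarrow> vec \<Rightarrow> vec" where
  "Ep k b M f = (\<lambda>(lam, m).
     \<Sum>mu\<in>{mu. wt mu = M}.
       (\<Prod>j\<in>set_mset mu. (- (2 * of_nat k * of_int b)) ^ count mu j
            * of_nat ((count lam j + count mu j) choose count mu j))
       * f (lam + mu, m))"

text \<open>mode (e^(b alpha))_p of Y(e^(b alpha), z) = E^- E^+ e^(b alpha) z^(b alpha)\<close>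
definition Yexp :: "nat \<Rightarrow> int \<Rightarrow> int \<Rightarrow> vec \<Rightarrow> vec" where
  "Yexp k b p f = (\<lambda>(lam, m).
     \<Sum>M. (let N = int M - p - 1 - 2 * int k * b * (m - b) in
           if N < 0 then 0 else Em b (nat N) (shiftL b (Ep k b M f)) (lam, m)))"

text \<open>modes of h(-j1-1)...h(-jr-1) e^(b alpha), via
  Y(h(-n) w, z) = : d^(n-1)/(n-1)! alpha(z) Y(w, z) : , i.e.
  (h(-n)w)_p = sum_{j<0} c_j alpha(j) w_{p-j-n} + sum_{j>=0} c_j w_{p-j-n} alpha(j),
  c_j = binom(-j-1, n-1).\<close>
primrec modeL :: "nat \<Rightarrow> nat list \<Rightarrow> int \<Rightarrow> int \<Rightarrow> vec \<Rightarrow> vec" where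
  "modeL k [] b p f = Yexp k b p f"
| "modeL k (j # js) b p f = (\<lambda>x.
     (\<Sum>i. ((of_int (int i) :: complex) gchoose j)
            * hop k (- (int i + 1)) (modeL k js b (p + int i - int j) f) x)
   + (\<Sum>i. ((of_int (- int i - 1) :: complex) gchoose j)
            * modeL k js b (p - int i - int j - 1) (hop k (int i) f) x))"

definition mode_basis :: "nat \<Rightarrow> basis \<Rightarrow> int \<Rightarrow> vec \<Rightarrow> vec" where
  "mode_basis k x p = modeL k (sorted_list_of_multiset (fst x)) (snd x) p"

definition vmode :: "nat \<Rightarrow> vec \<Rightarrow> int \<Rightarrow> vec \<Rightarrow> vec" where
  "vmode k v p u = (\<lambda>y. \<Sum>x\<in>{x. v x \<noteq> 0}. v x * mode_basis k x p u y)"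

text \<open>the involution theta: h(-n) to -h(-n), e^beta to e^(-beta)\<close>
definition theta :: "vec \<Rightarrow> vec" where
  "theta f = (\<lambda>(lam, m). (-1) ^ size lam * f (lam, - m))"

definition VLplus :: "vec set" where
  "VLplus = {f \<in> VL. theta f = f}"

definition M1 :: "vec set" where
  "M1 = {f \<in> VL. \<forall>lam m. m \<noteq> 0 \<longrightarrow> f (lam, m) = 0}"

definition M1plus :: "vec set" where
  "M1plus = {f \<in> M1. theta f = f}"

definition M1minus :: "vec set" where
  "M1minus = {f \<in> M1. theta f = (\<lambda>x. - f x)}"

definition tens :: "vec \<Rightarrow> int \<Rightarrow> vec" where
  "tens p m = (\<lambda>(lam, l). if l = m then p (lam, 0) else 0)"

definition VLplus1 :: "vec set" where
  "VLplus1 = {(\<lambda>x. tens p 1 x + tens p (-1) x + tens q 1 x - tens q (-1) x) | p q.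
                p \<in> M1plus \<and> q \<in> M1minus}"

inductive_set cspan :: "vec set \<Rightarrow> vec set" for S :: "vec set" where
  zero: "(\<lambda>_. 0) \<in> cspan S"
| base: "x \<in> S \<Longrightarrow> x \<in> cspan S"
| add: "x \<in> cspan S \<Longrightarrow> y \<in> cspan S \<Longrightarrow> (\<lambda>z. x z + y z) \<in> cspan S"
| smult: "x \<in> cspan S \<Longrightarrow> (\<lambda>z. c * x z) \<in> cspan S"

definition C2 :: "nat \<Rightarrow> vec set \<Rightarrow> vec set" where
  "C2 k V = cspan {vmode k v (-2) u | v u. v \<in> V \<and> u \<in> V}"

end

theory Submission
  imports Defs "HOL-Computational_Algebra.Formal_Power_Series"
begin

text \<open>
  Write \<open>V\<^sub>n\<close> for the part of \<open>V\<^sub>L\<^sup>+\<close> of charge \<open>\<plusminus>n\<close>, so that \<open>M(1)\<^sup>+ = V\<^sub>0\<close> and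
  \<open>V\<^sub>L\<^sup>+(1) = V\<^sub>1\<close>, and induct on \<open>n\<close>.  For \<open>u \<in> V\<^sub>n\<close> with \<open>n \<ge> 1\<close> and \<open>p \<le> -2\<close>, the vector
  \<open>(e\<^sup>\<alpha> + e\<^sup>-\<^sup>\<alpha>)\<^sub>p u\<close> lies in \<open>C\<^sub>2\<close>, since \<open>v\<^sub>-\<^sub>2\<^sub>-\<^sub>q\<close> is a multiple of \<open>(L(-1)\<^sup>q v)\<^sub>-\<^sub>2\<close>; its component of
  charge \<open>\<plusminus>(n-1)\<close> is known by induction.  If \<open>b\<close> is the component of charge \<open>n\<close> of \<open>u\<close> and
  \<open>p = -1-2kn-r\<close> with \<open>r \<ge> 0\<close>, then the component of charge \<open>n+1\<close> is \<open>\<Sum>\<^sub>M E\<^sup>-\<^sub>M\<^sub>+\<^sub>r E\<^sup>+\<^sub>M b\<close>.  All terms with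
  \<open>M > 0\<close> involve vectors \<open>E\<^sup>+\<^sub>M b\<close> of smaller weight, so induction on the weight of \<open>b\<close>, for all \<open>r\<close>
  simultaneously, shows that every \<open>E\<^sup>-\<^sub>r b\<close> is reached; \<open>r = 0\<close> gives everything in \<open>V\<^sub>n\<^sub>+\<^sub>1\<close>.
\<close>

section \<open>Weights and supports\<close>

lemma wt_empty [simp]: "wt {#} = 0"
  and wt_add_mset [simp]: "wt (add_mset j mu) = Suc j + wt mu"
  and wt_union [simp]: "wt (mu + nu) = wt mu + wt nu"
  by (simp_all add: wt_def)

lemma mem_less_wt: "j \<in># mu \<Longrightarrow> j < wt mu"
  by (induction mu) auto

lemma wt_remove: "j \<in># mu \<Longrightarrow> wt mu = Suc j + wt (mu - {#j#})"
  by (metis insert_DiffM wt_add_mset)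

lemma wt_eq_0_iff: "wt mu = 0 \<longleftrightarrow> mu = {#}"
  by (cases mu) auto

lemma wt_diff: "nu \<subseteq># mu \<Longrightarrow> wt mu = wt nu + wt (mu - nu)"
  by (metis subset_mset.add_diff_inverse wt_union)

lemma finite_wt_le: "finite {mu. wt mu \<le> n}"
proof -
  have "{mu. wt mu \<le> n} \<subseteq> mset ` {xs. set xs \<subseteq> {..<n} \<and> length xs \<le> n}"
  proof
    fix mu assume mu: "mu \<in> {mu. wt mu \<le> n}"
    obtain xs where xs: "mu = mset xs"
      by (metis ex_mset)
    with mu have "set xs \<subseteq> {..<n}" "length xs \<le> n"
      using mem_less_wt[of _ mu] by (fastforce, auto simp: wt_def)
    with xs show "mu \<in> mset ` {xs. set xs \<subseteq> {..<n} \<and> length xs \<le> n}"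
      by blast
  qed
  then show ?thesis
    by (rule finite_subset) (simp add: finite_lists_length_le)
qed

lemma finite_wt_eq: "finite {mu. wt mu = n}"
  by (rule finite_subset[OF _ finite_wt_le[of n]]) auto

lemma finite_submsets: "finite {mu. mu \<subseteq># (lam :: nat multiset) \<and> P mu}"
proof (rule finite_subset[OF _ finite_wt_le[of "wt lam"]])
  show "{mu. mu \<subseteq># lam \<and> P mu} \<subseteq> {mu. wt mu \<le> wt lam}"
    using wt_diff by fastforce
qed

text \<open>The bound \<open>C\<close> does not depend on \<open>mu\<close>, so a sum over
  partitions and a sum over part sizes can be exchanged in the recursions for \<open>Em\<close> and
  \<open>Ep\<close>.\<close>

lemma wt_eq_sum:
  assumes "wt mu \<le> C"
  shows "wt mu = (\<Sum>i\<le>C. Suc i * count mu i)"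
  using assms
proof (induction mu)
  case (add j mu)
  have "(\<Sum>i\<le>C. Suc i * count (add_mset j mu) i)
      = (\<Sum>i\<le>C. Suc i * count mu i + (if i = j then Suc j else 0))"
    by (intro sum.cong) auto
  also have "\<dots> = wt mu + Suc j"
    using add by (simp add: sum.distrib)
  finally show ?case by simp
qed simp

text \<open>Only the weight is bounded, not the charge. This suffices to truncate the series in
  \<open>Yexp\<close> and \<open>modeL\<close>, and it is inherited under nonnegative Heisenberg
  modes, \<open>Ep\<close> and \<open>theta\<close>.\<close>

definition wt_bound :: "nat \<Rightarrow> vec \<Rightarrow> bool" where
  "wt_bound w f \<longleftrightarrow> (\<forall>lam m. f (lam, m) \<noteq> 0 \<longrightarrow> wt lam \<le> w)"

lemma wt_bound_mono: "wt_bound w f \<Longrightarrow> w \<le> w' \<Longrightarrow> wt_bound w' f"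
  unfolding wt_bound_def by force

lemma VL_imp_wt_bound: "f \<in> VL \<Longrightarrow> \<exists>w. wt_bound w f"
proof
  assume "f \<in> VL"
  then have fin: "finite ((\<lambda>x. wt (fst x)) ` {x. f x \<noteq> 0})"
    by (simp add: VL_def)
  show "wt_bound (Max ((\<lambda>x. wt (fst x)) ` {x. f x \<noteq> 0})) f"
    unfolding wt_bound_def
  proof (intro allI impI)
    fix lam m assume "f (lam, m) \<noteq> 0"
    then have "wt (fst (lam, m)) \<in> (\<lambda>x. wt (fst x)) ` {x. f x \<noteq> 0}"
      by blast
    then show "wt lam \<le> Max ((\<lambda>x. wt (fst x)) ` {x. f x \<noteq> 0})"
      using fin by (simp add: Max_ge)
  qed
qed

lemma VL_0: "(\<lambda>_. 0) \<in> VL"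
  by (simp add: VL_def)

lemma VL_add: "f \<in> VL \<Longrightarrow> g \<in> VL \<Longrightarrow> (\<lambda>x. f x + g x) \<in> VL"
  unfolding VL_def
  by (auto intro: finite_subset[of _ "{x. f x \<noteq> 0} \<union> {x. g x \<noteq> 0}"])

lemma VL_smult: "f \<in> VL \<Longrightarrow> (\<lambda>x. c * f x) \<in> VL"
  unfolding VL_def by (auto intro: finite_subset[of _ "{x. f x \<noteq> 0}"])

lemma VL_support_le:
  assumes "f \<in> VL" "\<And>x. g x \<noteq> 0 \<Longrightarrow> f x \<noteq> 0"
  shows "g \<in> VL"
  using assms unfolding VL_def by (auto intro: finite_subset[of _ "{x. f x \<noteq> 0}"])

text \<open>Each support point of \<open>f\<close> accounts for one charge and, by
  \<open>finite_wt_le\<close>, finitely many partitions. The bound \<open>h\<close> is integer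
  valued because the degree formulas for modes can give negative numbers.\<close>

lemma VL_by_weight:
  fixes h :: "basis \<Rightarrow> int"
  assumes f: "f \<in> VL"
    and g: "\<And>lam m. g (lam, m) \<noteq> 0 \<Longrightarrow>
              \<exists>x. f x \<noteq> 0 \<and> m = snd x + b \<and> int (wt lam) \<le> h x"
  shows "g \<in> VL"
proof -
  have "{x. g x \<noteq> 0} \<subseteq> (\<Union>x\<in>{x. f x \<noteq> 0}. {lam. wt lam \<le> nat (h x)} \<times> {snd x + b})"
    using g by (fastforce simp: le_nat_iff)
  moreover have "finite (\<Union>x\<in>{x. f x \<noteq> 0}. {lam. wt lam \<le> nat (h x)} \<times> {snd x + b})"
    using f by (auto simp: VL_def finite_wt_le)
  ultimately show ?thesis
    unfolding VL_def using finite_subset by blast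
qed

section \<open>Creation and annihilation operators\<close>

text \<open>This is alpha(-i-1), separated from \<open>hop\<close> because it involves neither
  \<open>k\<close> nor an integer mode index.\<close>

definition cr :: "nat \<Rightarrow> vec \<Rightarrow> vec" where
  "cr i f = (\<lambda>(lam, m). if i \<in># lam then f (lam - {#i#}, m) else 0)"

lemma cr_apply: "cr i f (lam, m) = (if i \<in># lam then f (lam - {#i#}, m) else 0)"
  by (simp add: cr_def)

lemma hop_minus: "hop k (- (int i + 1)) f = cr i f"
  by (auto simp: hop_def cr_def fun_eq_iff nat_add_distrib)

lemma hop_0: "hop k 0 f (lam, m) = 2 * of_nat k * of_int m * f (lam, m)"
  by (simp add: hop_def)

lemma hop_Suc:
  "hop k (1 + int i) f (lam, m)
     = of_nat (Suc i) * 2 * of_nat k * of_nat (Suc (count lam i)) * f (add_mset i lam, m)"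
  by (simp add: hop_def nat_add_distrib algebra_simps)

lemma cr_sum: "cr i (\<lambda>x. \<Sum>a\<in>A. c a * g a x) x = (\<Sum>a\<in>A. c a * cr i (g a) x)"
  by (cases x) (simp add: cr_def)

lemma cr_add: "cr i (\<lambda>x. f x + g x) x = cr i f x + cr i g x"
  by (cases x) (simp add: cr_def)

lemma cr_smult: "cr i (\<lambda>x. c * f x) x = c * cr i f x"
  by (cases x) (simp add: cr_def)

lemma cr_eq_0: "wt (fst x) \<le> i \<Longrightarrow> cr i f x = 0"
  by (cases x) (auto simp: cr_def dest: mem_less_wt)

lemma cr_commute: "cr i (cr j f) x = cr j (cr i f) x"
  by (cases x; cases "i = j")
     (auto simp: cr_apply in_diff_count add_mset_commute)

text \<open>Truncations of mode series depend on the point of evaluation. Creation reads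
  \<open>f\<close> only at the same charge and at no larger weight, so a truncation valid at
  \<open>x\<close> can be used under \<open>cr i\<close>.\<close>

lemma cr_cong:
  assumes "\<And>y. wt (fst y) \<le> wt (fst x) \<Longrightarrow> snd y = snd x \<Longrightarrow> f y = g y"
  shows "cr i f x = cr i g x"
  using assms by (cases x) (auto simp: cr_apply dest: wt_remove)

lemma hop_int_cases:
  obtains "i = 0" | j where "i = Suc j" "int i = 1 + int j"
  by (cases i) auto

lemma hop_commute: "hop k (int i) (hop k (int j) f) = hop k (int j) (hop k (int i) f)"
proof
  fix x :: basis
  obtain lam m where x: "x = (lam, m)" by fastforce
  show "hop k (int i) (hop k (int j) f) x = hop k (int j) (hop k (int i) f) x"
    by (rule hop_int_cases[of i]; rule hop_int_cases[of j])
       (auto simp: x hop_0 hop_Suc add_mset_commute)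
qed

lemma hop_nz:
  assumes "hop k (int i) f (lam, m) \<noteq> 0"
  obtains lam' where "f (lam', m) \<noteq> 0" "wt lam' = i + wt lam"
proof (rule hop_int_cases[of i])
  assume "i = 0"
  then show thesis using assms that[of lam] by (auto simp: hop_0)
next
  fix j assume "i = Suc j" "int i = 1 + int j"
  then show thesis using assms that[of "add_mset j lam"] by (auto simp: hop_Suc)
qed

lemma wt_bound_hop: "wt_bound w f \<Longrightarrow> wt_bound (w - i) (hop k (int i) f)"
  unfolding wt_bound_def by (force elim!: hop_nz)

lemma wt_bound_hop': "wt_bound w f \<Longrightarrow> wt_bound w (hop k (int i) f)"
  by (rule wt_bound_mono[OF wt_bound_hop]) auto

lemma hop_eq_0: "wt_bound w f \<Longrightarrow> w < i \<Longrightarrow> hop k (int i) f = (\<lambda>_. 0)"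
  unfolding wt_bound_def by (rule ext, rule ccontr) (force elim!: hop_nz)

section \<open>The exponential operators\<close>

text \<open>Adding a part \<open>i\<close> changes only the factor at \<open>i\<close>; the
  condition \<open>u j 0 = 1\<close> covers the case in which \<open>i\<close> is new to the index
  set. Both exponentials use this.\<close>

lemma prod_count_add_mset:
  fixes u :: "nat \<Rightarrow> nat \<Rightarrow> complex"
  assumes "\<And>j. u j 0 = 1" and "c * u i (Suc (count mu i)) = d * u i (count mu i)"
  shows "c * (\<Prod>j\<in>set_mset (add_mset i mu). u j (count (add_mset i mu) j))
       = d * (\<Prod>j\<in>set_mset mu. u j (count mu j))"
proof -
  have "(\<Prod>j\<in>set_mset (add_mset i mu). u j (count (add_mset i mu) j))
      = u i (Suc (count mu i)) * (\<Prod>j\<in>set_mset mu - {i}. u j (count mu j))"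
    by (subst prod.remove[of _ i]) (auto intro!: prod.cong)
  moreover have "(\<Prod>j\<in>set_mset mu. u j (count mu j))
      = u i (count mu i) * (\<Prod>j\<in>set_mset mu - {i}. u j (count mu j))"
  proof (cases "i \<in># mu")
    case True
    then show ?thesis by (subst prod.remove[of _ i]) auto
  next
    case False
    then show ?thesis using assms(1) by (simp add: not_in_iff)
  qed
  ultimately show ?thesis
    using assms(2) by (metis mult.assoc)
qed

definition Em_coeff :: "int \<Rightarrow> nat multiset \<Rightarrow> complex" where
  "Em_coeff b mu = (\<Prod>j\<in>set_mset mu. (of_int b / of_nat (j+1)) ^ count mu j / fact (count mu j))"

text \<open>Applying alpha(j+1)^c / c! down to multiplicity l contributes (2k(j+1))^c binom(l+c, c);
  the factor (-b/(j+1))^c of the exponential cancels the powers of j+1.\<close>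

definition Ep_coeff :: "nat \<Rightarrow> int \<Rightarrow> nat multiset \<Rightarrow> nat multiset \<Rightarrow> complex" where
  "Ep_coeff k b lam mu = (\<Prod>j\<in>set_mset mu. (- (2 * of_nat k * of_int b)) ^ count mu j
            * of_nat ((count lam j + count mu j) choose count mu j))"

lemma Em_apply:
  "Em b N f (lam, m) = (\<Sum>mu | mu \<subseteq># lam \<and> wt mu = N. Em_coeff b mu * f (lam - mu, m))"
  by (simp add: Em_def Em_coeff_def)

lemma Ep_apply:
  "Ep k b M f (lam, m) = (\<Sum>mu | wt mu = M. Ep_coeff k b lam mu * f (lam + mu, m))"
  by (simp add: Ep_def Ep_coeff_def)

lemma Em_coeff_add_mset:
  "of_nat (Suc i * Suc (count mu i)) * Em_coeff b (add_mset i mu) = of_int b * Em_coeff b mu"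
  unfolding Em_coeff_def
  by (rule prod_count_add_mset) (auto simp: of_nat_mult field_simps simp del: of_nat_Suc mult_Suc mult_Suc_right)

lemma Ep_coeff_add_mset:
  "of_nat (Suc (count mu i)) * Ep_coeff k b lam (add_mset i mu)
     = - (2 * of_nat k * of_int b * of_nat (Suc (count lam i + count mu i))) * Ep_coeff k b lam mu"
  unfolding Ep_coeff_def
proof (rule prod_count_add_mset)
  let ?l = "count lam i" and ?n = "count mu i"
  have "of_nat (Suc ?n) * (of_nat (?l + Suc ?n choose Suc ?n) :: complex)
      = of_nat (Suc (?l + ?n)) * of_nat (?l + ?n choose ?n)"
    using Suc_times_binomial[of ?n "?l + ?n"] by (metis add_Suc_right of_nat_mult)
  then have "c ^ Suc ?n * (of_nat (Suc ?n) * of_nat (?l + Suc ?n choose Suc ?n))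
      = c * of_nat (Suc (?l + ?n)) * (c ^ ?n * of_nat (?l + ?n choose ?n))" for c :: complex
    by (simp only: power_Suc mult_ac)
  from this[of "- (2 * of_nat k * of_int b)"]
  show "of_nat (Suc ?n) * ((- (2 * of_nat k * of_int b)) ^ Suc ?n
               * of_nat (?l + Suc ?n choose Suc ?n))
      = - (2 * of_nat k * of_int b * of_nat (Suc (?l + ?n)))
          * ((- (2 * of_nat k * of_int b)) ^ ?n * (of_nat (?l + ?n choose ?n) :: complex))"
    by (simp only: mult.left_commute mult.assoc mult_minus_left)
qed simp

lemma Em_0: "Em b 0 f = f"
proof -
  have "{mu. mu \<subseteq># lam \<and> wt mu = 0} = {{#}}" for lam :: "nat multiset"
    by (auto simp: wt_eq_0_iff)
  then show ?thesis by (auto simp: Em_apply Em_coeff_def)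
qed

lemma Ep_0: "Ep k b 0 f = f"
  by (auto simp: Ep_apply Ep_coeff_def wt_eq_0_iff)

lemma Em_sum: "Em b N (\<lambda>x. \<Sum>a\<in>A. c a * g a x) x = (\<Sum>a\<in>A. c a * Em b N (g a) x)"
  by (cases x) (auto simp: Em_apply sum_distrib_left algebra_simps intro: sum.swap)

lemma Em_smult: "Em b N (\<lambda>x. c * f x) x = c * Em b N f x"
  by (cases x) (simp add: Em_apply sum_distrib_left algebra_simps)

lemma Em_add: "Em b N (\<lambda>x. f x + g x) x = Em b N f x + Em b N g x"
  by (cases x) (simp add: Em_apply sum.distrib algebra_simps)

lemma Ep_add: "Ep k b M (\<lambda>x. f x + g x) x = Ep k b M f x + Ep k b M g x"
  by (cases x) (simp add: Ep_apply sum.distrib algebra_simps)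

lemma Ep_smult: "Ep k b M (\<lambda>x. c * f x) x = c * Ep k b M f x"
  by (cases x) (simp add: Ep_apply sum_distrib_left algebra_simps)

lemma Em_nz:
  assumes "Em b N f (lam, m) \<noteq> 0"
  obtains lam' where "f (lam', m) \<noteq> 0" "wt lam = N + wt lam'"
proof -
  obtain mu where "mu \<subseteq># lam" "wt mu = N" "f (lam - mu, m) \<noteq> 0"
    using assms unfolding Em_apply by (auto elim!: sum.not_neutral_contains_not_neutral)
  then show thesis using that wt_diff by metis
qed

lemma Ep_nz:
  assumes "Ep k b M f (lam, m) \<noteq> 0"
  obtains lam' where "f (lam', m) \<noteq> 0" "wt lam' = wt lam + M"
proof -
  obtain mu where "wt mu = M" "f (lam + mu, m) \<noteq> 0"
    using assms unfolding Ep_apply by (auto elim!: sum.not_neutral_contains_not_neutral)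
  then show thesis using that by (metis wt_union)
qed

lemma Ep_eq_0: "wt_bound w f \<Longrightarrow> w < M \<Longrightarrow> Ep k b M f = (\<lambda>_. 0)"
  unfolding wt_bound_def by (rule ext, rule ccontr) (force elim!: Ep_nz)

lemma wt_bound_Ep: "wt_bound w f \<Longrightarrow> wt_bound (w - M) (Ep k b M f)"
  unfolding wt_bound_def by (force elim!: Ep_nz)

lemma VL_Ep: "f \<in> VL \<Longrightarrow> Ep k b M f \<in> VL"
  by (rule VL_by_weight[of f _ 0 "\<lambda>x. int (wt (fst x))"]) (auto elim!: Ep_nz)

lemma VL_Em: "f \<in> VL \<Longrightarrow> Em b N f \<in> VL"
  by (rule VL_by_weight[of f _ 0 "\<lambda>x. int (wt (fst x) + N)"]) (auto elim!: Em_nz)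

lemma shiftL_apply: "shiftL b f (lam, m) = f (lam, m - b)"
  by (simp add: shiftL_def)

lemma shiftL_0_fun: "shiftL b (\<lambda>_. 0) = (\<lambda>_. 0)"
  by (auto simp: shiftL_def)

text \<open>Extension by zero to negative degrees matches the case split in \<open>Yexp\<close> and
  makes the recursion \<open>Emi_rec\<close> valid in every integer degree.\<close>

definition Emi :: "int \<Rightarrow> int \<Rightarrow> vec \<Rightarrow> vec" where
  "Emi b N f = (if N < 0 then (\<lambda>_. 0) else Em b (nat N) f)"

lemma Emi_of_nat: "Emi b (int N) f = Em b N f"
  by (simp add: Emi_def)

lemma Emi_0_fun: "Emi b N (\<lambda>_. 0) = (\<lambda>_. 0)"
  by (auto simp: Emi_def Em_apply)

lemma Emi_sum: "Emi b N (\<lambda>x. \<Sum>a\<in>A. c a * g a x) x = (\<Sum>a\<in>A. c a * Emi b N (g a) x)"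
  by (simp add: Emi_def Em_sum)

lemma Emi_smult: "Emi b N (\<lambda>x. c * f x) x = c * Emi b N f x"
  by (simp add: Emi_def Em_smult)

lemma Emi_add: "Emi b N (\<lambda>x. f x + g x) x = Emi b N f x + Emi b N g x"
  by (simp add: Emi_def Em_add)

section \<open>Euler recursions for the exponential operators\<close>

lemma Em_count_sum:
  "(\<Sum>mu | mu \<subseteq># lam \<and> wt mu = N. of_nat (Suc i * count mu i) * (Em_coeff b mu * f (lam - mu, m)))
     = of_int b * cr i (Emi b (int N - 1 - int i) f) (lam, m)"
proof (cases "i \<in># lam \<and> Suc i \<le> N")
  case False
  have "count mu i = 0" if "mu \<subseteq># lam" "wt mu = N" for mu
    using False that mem_less_wt[of i mu] mset_subset_eqD by (metis Suc_leI not_in_iff)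
  moreover have "cr i (Emi b (int N - 1 - int i) f) (lam, m) = 0"
    using False by (auto simp: cr_apply Emi_def)
  ultimately show ?thesis by (auto intro: sum.neutral)
next
  case True
  then have N: "nat (int N - 1 - int i) = N - Suc i" "\<not> int N - 1 - int i < 0"
    by auto
  let ?g = "\<lambda>mu. of_nat (Suc i * count mu i) * (Em_coeff b mu * f (lam - mu, m))"
  let ?A = "{nu. nu \<subseteq># lam - {#i#} \<and> wt nu = N - Suc i}"
  \<comment> \<open>Partitions without the part \<open>i\<close> contribute zero; the others are
    \<open>add_mset i nu\<close> with \<open>nu\<close> contained in
    \<open>lam - {#i#}\<close>.\<close>
  have "(\<Sum>mu | mu \<subseteq># lam \<and> wt mu = N. ?g mu) = (\<Sum>mu\<in>add_mset i ` ?A. ?g mu)"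
  proof (rule sum.mono_neutral_right)
    show "add_mset i ` ?A \<subseteq> {mu. mu \<subseteq># lam \<and> wt mu = N}"
      using True by (auto simp: insert_subset_eq_iff)
    show "\<forall>mu\<in>{mu. mu \<subseteq># lam \<and> wt mu = N} - add_mset i ` ?A. ?g mu = 0"
    proof
      fix mu assume mu: "mu \<in> {mu. mu \<subseteq># lam \<and> wt mu = N} - add_mset i ` ?A"
      have "i \<notin># mu"
      proof
        assume "i \<in># mu"
        then have "mu = add_mset i (mu - {#i#})" by simp
        moreover have "mu - {#i#} \<in> ?A"
          using mu wt_remove[OF \<open>i \<in># mu\<close>] insert_subset_eq_iff[of i "mu - {#i#}" lam] \<open>i \<in># mu\<close>
          by auto
        ultimately show False using mu by blast
      qed
      then show "?g mu = 0" by (simp add: not_in_iff)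
    qed
  qed (rule finite_submsets)
  also have "\<dots> = (\<Sum>nu\<in>?A. ?g (add_mset i nu))"
    by (rule sum.reindex[unfolded comp_def]) (simp add: inj_on_def)
  also have "\<dots> = (\<Sum>nu\<in>?A. of_int b * (Em_coeff b nu * f (lam - {#i#} - nu, m)))"
  proof (rule sum.cong)
    fix nu
    have "?g (add_mset i nu)
        = (of_nat (Suc i * Suc (count nu i)) * Em_coeff b (add_mset i nu)) * f (lam - add_mset i nu, m)"
      by (simp add: mult.assoc)
    then show "?g (add_mset i nu) = of_int b * (Em_coeff b nu * f (lam - {#i#} - nu, m))"
      unfolding Em_coeff_add_mset by (simp add: mult.assoc)
  qed simp
  also have "\<dots> = of_int b * cr i (Emi b (int N - 1 - int i) f) (lam, m)"
    using True N by (simp add: cr_apply Emi_def Em_apply sum_distrib_left)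
  finally show ?thesis .
qed

text \<open>With A = sum of b alpha(-n) z^n / n, this is the coefficient of z^N in z d/dz exp(A) =
  (z dA/dz) exp(A): the weight \<open>N\<close> of each \<open>mu\<close> is distributed over its
  parts. Terms with \<open>i\<close> at least \<open>wt lam\<close> vanish, so \<open>C\<close> may
  be enlarged freely.\<close>

lemma Em_rec:
  assumes "wt lam \<le> C"
  shows "of_nat N * Em b N f (lam, m)
       = of_int b * (\<Sum>i\<le>C. cr i (Emi b (int N - 1 - int i) f) (lam, m))"
proof -
  have "of_nat N * Em b N f (lam, m)
      = (\<Sum>mu | mu \<subseteq># lam \<and> wt mu = N. \<Sum>i\<le>C. of_nat (Suc i * count mu i) * (Em_coeff b mu * f (lam - mu, m)))"
    unfolding Em_apply sum_distrib_left
  proof (rule sum.cong)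
    fix mu assume "mu \<in> {mu. mu \<subseteq># lam \<and> wt mu = N}"
    then have "N = (\<Sum>i\<le>C. Suc i * count mu i)"
      using assms wt_eq_sum[of mu C] wt_diff[of mu lam] by auto
    then have "of_nat N = (\<Sum>i\<le>C. of_nat (Suc i * count mu i) :: complex)"
      by (metis of_nat_sum)
    then show "of_nat N * (Em_coeff b mu * f (lam - mu, m))
       = (\<Sum>i\<le>C. of_nat (Suc i * count mu i) * (Em_coeff b mu * f (lam - mu, m)))"
      by (simp only: sum_distrib_right)
  qed simp
  also have "\<dots> = (\<Sum>i\<le>C. of_int b * cr i (Emi b (int N - 1 - int i) f) (lam, m))"
    by (subst sum.swap) (simp only: Em_count_sum)
  finally show ?thesis by (simp add: sum_distrib_left)
qed

lemma Emi_rec: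
  assumes "wt lam \<le> C"
  shows "of_int N * Emi b N f (lam, m)
       = of_int b * (\<Sum>i\<le>C. cr i (Emi b (N - 1 - int i) f) (lam, m))"
proof (cases "N < 0")
  case True
  then show ?thesis by (simp add: Emi_def cr_apply)
next
  case False
  then obtain n where "N = int n" by (metis nonneg_int_cases not_less)
  then show ?thesis using Em_rec[OF assms, of n] by (simp add: Emi_of_nat)
qed

lemma Ep_count_sum:
  "(\<Sum>mu | wt mu = M. of_nat (Suc i * count mu i) * (Ep_coeff k b lam mu * f (lam + mu, m)))
     = - of_int b * (if Suc i \<le> M then Ep k b (M - Suc i) (hop k (int (Suc i)) f) (lam, m) else 0)"
proof (cases "Suc i \<le> M")
  case False
  have "count mu i = 0" if "wt mu = M" for mu
    using False that mem_less_wt[of i mu] by (metis Suc_leI not_in_iff)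
  with False show ?thesis by (auto intro: sum.neutral)
next
  case True
  let ?g = "\<lambda>mu. of_nat (Suc i * count mu i) * (Ep_coeff k b lam mu * f (lam + mu, m))"
  let ?A = "{nu. wt nu = M - Suc i}"
  have "(\<Sum>mu | wt mu = M. ?g mu) = (\<Sum>mu\<in>add_mset i ` ?A. ?g mu)"
  proof (rule sum.mono_neutral_right)
    show "add_mset i ` ?A \<subseteq> {mu. wt mu = M}"
      using True by auto
    show "\<forall>mu\<in>{mu. wt mu = M} - add_mset i ` ?A. ?g mu = 0"
    proof
      fix mu assume mu: "mu \<in> {mu. wt mu = M} - add_mset i ` ?A"
      have "i \<notin># mu"
      proof
        assume "i \<in># mu"
        then have "mu = add_mset i (mu - {#i#})" "mu - {#i#} \<in> ?A"
          using mu wt_remove[of i mu] by auto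
        then show False using mu by blast
      qed
      then show "?g mu = 0" by (simp add: not_in_iff)
    qed
  qed (rule finite_wt_eq)
  also have "\<dots> = (\<Sum>nu\<in>?A. ?g (add_mset i nu))"
    by (rule sum.reindex[unfolded comp_def]) (simp add: inj_on_def)
  also have "\<dots> = (\<Sum>nu\<in>?A. - of_int b * (Ep_coeff k b lam nu * hop k (1 + int i) f (lam + nu, m)))"
  proof (rule sum.cong)
    fix nu
    have "?g (add_mset i nu)
        = of_nat (Suc i) * (of_nat (Suc (count nu i)) * Ep_coeff k b lam (add_mset i nu))
            * f (lam + add_mset i nu, m)"
      by (simp only: of_nat_mult count_add_mset if_True refl mult.assoc)
    then show "?g (add_mset i nu)
        = - of_int b * (Ep_coeff k b lam nu * hop k (1 + int i) f (lam + nu, m))"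
      unfolding Ep_coeff_add_mset hop_Suc by (simp add: algebra_simps del: of_nat_Suc)
  qed simp
  also have "\<dots> = - of_int b * Ep k b (M - Suc i) (hop k (int (Suc i)) f) (lam, m)"
    by (simp add: Ep_apply sum_distrib_left)
  finally show ?thesis using True by simp
qed

text \<open>The same Euler identity for E^+ in powers of z^(-1). Since annihilation operators
  commute, the factor brought down by differentiation can act on \<open>f\<close> first.\<close>

lemma Ep_rec:
  assumes "M \<le> C"
  shows "of_nat M * Ep k b M f x
       = - of_int b * (\<Sum>i<C. if Suc i \<le> M then Ep k b (M - Suc i) (hop k (int (Suc i)) f) x else 0)"
proof -
  obtain lam m where x: "x = (lam, m)" by fastforce
  have "of_nat M * Ep k b M f (lam, m)
      = (\<Sum>mu | wt mu = M. \<Sum>i<C. of_nat (Suc i * count mu i) * (Ep_coeff k b lam mu * f (lam + mu, m)))"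
    unfolding Ep_apply sum_distrib_left
  proof (rule sum.cong)
    fix mu assume mu: "mu \<in> {mu. wt mu = M}"
    then have "count mu C = 0"
      using assms mem_less_wt[of C mu] by (force simp: not_in_iff)
    then have "M = (\<Sum>i<C. Suc i * count mu i)"
      using assms mu wt_eq_sum[of mu C] by (simp flip: lessThan_Suc_atMost)
    then have "of_nat M = (\<Sum>i<C. of_nat (Suc i * count mu i) :: complex)"
      by (metis of_nat_sum)
    then show "of_nat M * (Ep_coeff k b lam mu * f (lam + mu, m))
       = (\<Sum>i<C. of_nat (Suc i * count mu i) * (Ep_coeff k b lam mu * f (lam + mu, m)))"
      by (simp only: sum_distrib_right)
  qed simp
  also have "\<dots> = (\<Sum>i<C. - of_int b * (if Suc i \<le> M then Ep k b (M - Suc i) (hop k (int (Suc i)) f) (lam, m) else 0))"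
    by (subst sum.swap) (simp only: Ep_count_sum)
  finally show ?thesis by (simp only: sum_distrib_left x)
qed

section \<open>Modes of the exponential vectors\<close>

lemma suminf_nz:
  fixes g :: "nat \<Rightarrow> complex"
  assumes "suminf g \<noteq> 0"
  obtains n where "g n \<noteq> 0"
proof (rule ccontr)
  assume "\<not> thesis"
  then have "g = (\<lambda>_. 0)" using that by blast
  then show False using assms by simp
qed

lemma suminf_eq_sum_atMost:
  fixes g :: "nat \<Rightarrow> complex"
  assumes "\<And>i. i > C \<Longrightarrow> g i = 0"
  shows "suminf g = sum g {..C}"
  by (rule suminf_finite) (use assms in auto)

text \<open>E^+ lowers the weight by \<open>M\<close>, hence kills \<open>f\<close> once
  \<open>M > w\<close>. Allowing any \<open>C\<close> above \<open>w\<close> gives several vectors a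
  common summation range.\<close>

lemma Yexp_sum:
  assumes "wt_bound w f" "w \<le> C"
  shows "Yexp k b p f (lam, m)
    = (\<Sum>M\<le>C. Emi b (int M - p - 1 - 2 * int k * b * (m - b)) (shiftL b (Ep k b M f)) (lam, m))"
proof -
  have "Yexp k b p f (lam, m)
    = (\<Sum>M. Emi b (int M - p - 1 - 2 * int k * b * (m - b)) (shiftL b (Ep k b M f)) (lam, m))"
    unfolding Yexp_def Emi_def Let_def by (auto intro!: suminf_cong)
  also have "\<dots> = (\<Sum>M\<le>C. Emi b (int M - p - 1 - 2 * int k * b * (m - b)) (shiftL b (Ep k b M f)) (lam, m))"
  proof (rule suminf_eq_sum_atMost)
    fix M assume "M > C"
    then have "shiftL b (Ep k b M f) = (\<lambda>_. 0)"
      using assms by (simp add: Ep_eq_0[OF assms(1)] shiftL_0_fun)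
    then show "Emi b (int M - p - 1 - 2 * int k * b * (m - b)) (shiftL b (Ep k b M f)) (lam, m) = 0"
      by (simp add: Emi_0_fun)
  qed
  finally show ?thesis .
qed

lemma wt_bound_linear: "wt_bound w f \<Longrightarrow> wt_bound w g \<Longrightarrow> wt_bound w (\<lambda>x. c * f x + g x)"
  unfolding wt_bound_def by (metis add_0 mult_zero_right)

text \<open>The p-th mode of a vector of conformal weight d raises degree by d - p - 1. Since e^(m
  alpha) has weight k m^2, comparing k b^2 + k (m-b)^2 with k m^2 leaves the cross term
  -2kb(m-b).\<close>

lemma Yexp_nz:
  assumes "Yexp k b p f (lam, m) \<noteq> 0"
  obtains lam' where "f (lam', m - b) \<noteq> 0"
    "int (wt lam) = int (wt lam') - p - 1 - 2 * int k * b * (m - b)"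
proof -
  let ?N = "\<lambda>M. int M - p - 1 - 2 * int k * b * (m - b)"
  obtain M where M: "(let N = ?N M in
      if N < 0 then 0 else Em b (nat N) (shiftL b (Ep k b M f)) (lam, m)) \<noteq> 0"
    using assms unfolding Yexp_def by (auto elim: suminf_nz)
  then have N: "?N M \<ge> 0" and "Em b (nat (?N M)) (shiftL b (Ep k b M f)) (lam, m) \<noteq> 0"
    by (auto simp: Let_def split: if_splits)
  then obtain mu where "Ep k b M f (mu, m - b) \<noteq> 0" "wt lam = nat (?N M) + wt mu"
    by (auto elim!: Em_nz simp: shiftL_apply)
  then show thesis
    using N that by (auto elim!: Ep_nz)
qed

lemma Yexp_linear:
  assumes "wt_bound w f" "wt_bound w g"
  shows "Yexp k b p (\<lambda>x. c * f x + g x) = (\<lambda>x. c * Yexp k b p f x + Yexp k b p g x)"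
proof
  fix x :: basis
  obtain lam m where x: "x = (lam, m)" by fastforce
  have "shiftL b (Ep k b M (\<lambda>x. c * f x + g x))
      = (\<lambda>x. c * shiftL b (Ep k b M f) x + shiftL b (Ep k b M g) x)" for M
    by (auto simp: shiftL_def Ep_add Ep_smult)
  then show "Yexp k b p (\<lambda>x. c * f x + g x) x = c * Yexp k b p f x + Yexp k b p g x"
    using assms wt_bound_linear[OF assms]
    by (simp add: x Yexp_sum[where w = w and C = w] Emi_add Emi_smult sum.distrib sum_distrib_left)
qed

text \<open>The component form of \<open>Y(L(-1) e\<^sup>b, z) = d/dz Y(e\<^sup>b, z)\<close>.\<close>

lemma Yexp_derivative:
  assumes f: "wt_bound w f" and C: "w \<le> C" "wt (fst x) \<le> C"
  shows "of_int b * ((\<Sum>i\<le>C. cr i (Yexp k b (r + int i) f) x)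
                     + (\<Sum>i\<le>C. Yexp k b (r - 1 - int i) (hop k (int i) f) x))
       = - of_int r * Yexp k b (r - 1) f x"
proof -
  obtain lam m where x: "x = (lam, m)" by fastforce
  \<comment> \<open>\<open>s\<close> is the exponent of z that z^(b alpha) produces on charge m - b,
    and \<open>T n M g\<close> is the M-th summand of the mode of index r - 1 - n applied to
    g.\<close>
  define s where "s = 2 * int k * b * (m - b)"
  define T where "T = (\<lambda>n M g. Emi b (n + int M - r - s) (shiftL b (Ep k b M g)) (lam, m))"
  have Y: "Yexp k b (r - 1 - n) g (lam, m) = (\<Sum>M\<le>C. T n M g)" if "wt_bound w' g" "w' \<le> C" for n w' g
    using that by (simp add: Yexp_sum[of w' g C] T_def s_def algebra_simps)
  have Y0: "Yexp k b (r - 1) f (lam, m) = (\<Sum>M\<le>C. T 0 M f)"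
    using Y[OF f C(1), of 0] by simp
  have crY: "cr i (Yexp k b (r + int i) f) (lam, m)
      = (\<Sum>M\<le>C. cr i (Emi b (int M - r - s - 1 - int i) (shiftL b (Ep k b M f))) (lam, m))" for i
  proof (cases "i \<in># lam")
    case True
    then show ?thesis
      by (simp add: cr_apply Yexp_sum[OF f C(1)] s_def algebra_simps)
  qed (simp add: cr_apply)
  \<comment> \<open>Product rule: on the M-th summand the exponents M - r - s of E^-, s of z^(b
    alpha) and -M of E^+ add up to -r. Differentiating E^- gives the creation terms, z^(b alpha)
    gives alpha(0), and E^+ gives the positive modes.\<close>
  have creation: "(\<Sum>M\<le>C. of_int (int M - r - s) * T 0 M f)
      = of_int b * (\<Sum>i\<le>C. cr i (Yexp k b (r + int i) f) (lam, m))"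
  proof -
    have "of_int (int M - r - s) * T 0 M f = (\<Sum>i\<le>C. of_int b *
        cr i (Emi b (int M - r - s - 1 - int i) (shiftL b (Ep k b M f))) (lam, m))" for M
      using C(2) Emi_rec[of lam C "int M - r - s"] by (simp add: x T_def sum_distrib_left)
    then show ?thesis
      by (simp only: crY sum_distrib_left) (rule sum.swap)
  qed
  have hop0: "(\<Sum>M\<le>C. of_int s * T 0 M f) = of_int b * Yexp k b (r - 1) (hop k 0 f) (lam, m)"
  proof -
    have shift: "shiftL b (Ep k b M (hop k 0 f)) (mu, m)
        = 2 * of_nat k * of_int (m - b) * shiftL b (Ep k b M f) (mu, m)" for M mu
      by (simp add: shiftL_apply Ep_apply hop_0 sum_distrib_left algebra_simps)
    have "Emi b N (shiftL b (Ep k b M (hop k 0 f))) (lam, m)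
        = 2 * of_nat k * of_int (m - b) * Emi b N (shiftL b (Ep k b M f)) (lam, m)" for M N
      unfolding Emi_def by (simp add: Em_apply shift sum_distrib_left mult_ac del: of_int_diff)
    then have "of_int s * T 0 M f = of_int b * T 0 M (hop k 0 f)" for M
      by (simp add: T_def s_def)
    then show ?thesis
      using Y[of w "hop k 0 f" 0] wt_bound_hop'[OF f, of k 0] C
      by (simp add: sum_distrib_left)
  qed
  have hopSuc: "(\<Sum>M\<le>C. if Suc i \<le> M then Emi b (int M - r - s)
        (shiftL b (Ep k b (M - Suc i) (hop k (int (Suc i)) f))) (lam, m) else 0)
      = Yexp k b (r - 1 - int (Suc i)) (hop k (int (Suc i)) f) (lam, m)" if "i < C" for i
  proof -
    let ?g = "hop k (int (Suc i)) f"
    \<comment> \<open>Since alpha(i+1) lowers the weight bound by i + 1, the range left after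
      shifting \<open>M\<close> by \<open>Suc i\<close> can be extended back to all of
      {..C}.\<close>
    have zero: "T n M ?g = 0" if "M > C - Suc i" for n M
    proof -
      have "Ep k b M ?g = (\<lambda>_. 0)"
        by (rule Ep_eq_0[OF wt_bound_hop[OF f]]) (use that C in auto)
      then show ?thesis
        by (simp add: T_def shiftL_0_fun Emi_0_fun)
    qed
    have "(\<Sum>M\<le>C. if Suc i \<le> M then Emi b (int M - r - s) (shiftL b (Ep k b (M - Suc i) ?g)) (lam, m) else 0)
        = (\<Sum>M\<in>{Suc i..C}. T (int (Suc i)) (M - Suc i) ?g)"
      by (rule sum.mono_neutral_cong_right) (auto simp: T_def of_nat_diff)
    also have "\<dots> = (\<Sum>M\<in>{..C - Suc i}. T (int (Suc i)) M ?g)"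
      by (rule sum.reindex_bij_witness[of _ "\<lambda>M. M + Suc i" "\<lambda>M. M - Suc i"]) (use that in auto)
    also have "\<dots> = (\<Sum>M\<le>C. T (int (Suc i)) M ?g)"
      by (rule sum.mono_neutral_left) (use zero not_le in auto)
    also have "\<dots> = Yexp k b (r - 1 - int (Suc i)) ?g (lam, m)"
      by (rule Y[symmetric, OF wt_bound_hop'[OF f] C(1)])
    finally show ?thesis .
  qed
  have "- (\<Sum>M\<le>C. of_nat M * T 0 M f)
      = of_int b * (\<Sum>i<C. Yexp k b (r - 1 - int (Suc i)) (hop k (int (Suc i)) f) (lam, m))"
  proof -
    have "- (of_nat M * T 0 M f) = of_int b * (\<Sum>i<C. if Suc i \<le> M then Emi b (int M - r - s)
        (shiftL b (Ep k b (M - Suc i) (hop k (int (Suc i)) f))) (lam, m) else 0)" if "M \<le> C" for M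
    proof -
      have "(\<lambda>x. of_nat M * shiftL b (Ep k b M f) x) = (\<lambda>x. \<Sum>i<C. - of_int b *
          (if Suc i \<le> M then shiftL b (Ep k b (M - Suc i) (hop k (int (Suc i)) f)) else (\<lambda>_. 0)) x)"
        by (auto simp: fun_eq_iff shiftL_apply Ep_rec[OF that] sum_distrib_left simp del: of_nat_Suc
            intro!: sum.cong)
      then have "of_nat M * T 0 M f = (\<Sum>i<C. - of_int b * Emi b (int M - r - s)
          (if Suc i \<le> M then shiftL b (Ep k b (M - Suc i) (hop k (int (Suc i)) f)) else (\<lambda>_. 0)) (lam, m))"
        unfolding T_def by (simp only: Emi_smult[where c = "of_nat M", symmetric] Emi_sum add_0)
      then show ?thesis
        by (simp add: sum_negf sum_distrib_left) (auto simp: Emi_0_fun intro!: sum.cong)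
    qed
    then have "- (\<Sum>M\<le>C. of_nat M * T 0 M f)
        = (\<Sum>M\<le>C. of_int b * (\<Sum>i<C. if Suc i \<le> M then Emi b (int M - r - s)
        (shiftL b (Ep k b (M - Suc i) (hop k (int (Suc i)) f))) (lam, m) else 0))"
      by (simp flip: sum_negf)
    also have "\<dots> = of_int b * (\<Sum>i<C. \<Sum>M\<le>C. if Suc i \<le> M then Emi b (int M - r - s)
        (shiftL b (Ep k b (M - Suc i) (hop k (int (Suc i)) f))) (lam, m) else 0)"
      by (subst sum.swap) (simp only: sum_distrib_left)
    also have "(\<Sum>i<C. \<Sum>M\<le>C. if Suc i \<le> M then Emi b (int M - r - s)
        (shiftL b (Ep k b (M - Suc i) (hop k (int (Suc i)) f))) (lam, m) else 0)
        = (\<Sum>i<C. Yexp k b (r - 1 - int (Suc i)) (hop k (int (Suc i)) f) (lam, m))"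
      by (intro sum.cong refl hopSuc) simp
    finally show ?thesis .
  qed
  moreover have "(\<Sum>i\<le>C. Yexp k b (r - 1 - int i) (hop k (int i) f) (lam, m))
      = Yexp k b (r - 1) (hop k 0 f) (lam, m)
        + (\<Sum>i<C. Yexp k b (r - 1 - int (Suc i)) (hop k (int (Suc i)) f) (lam, m))"
    by (subst sum.atMost_shift) simp
  moreover have "- of_int r * Yexp k b (r - 1) f (lam, m)
      = (\<Sum>M\<le>C. of_int (int M - r - s) * T 0 M f) + (\<Sum>M\<le>C. of_int s * T 0 M f)
        - (\<Sum>M\<le>C. of_nat M * T 0 M f)"
    by (simp add: Y0 sum_distrib_left flip: sum.distrib sum_subtractf) (simp add: algebra_simps)
  ultimately show ?thesis
    unfolding x by (simp only: creation hop0) (simp add: algebra_simps)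
qed

section \<open>Modes of arbitrary vectors\<close>

lemma modeL_Cons:
  "modeL k (j # js) b p f x =
     (\<Sum>i. (of_nat i gchoose j) * cr i (modeL k js b (p + int i - int j) f) x)
   + (\<Sum>i. ((- of_nat i - 1) gchoose j) * modeL k js b (p - int i - int j - 1) (hop k (int i) f) x)"
  by (simp add: hop_minus[of k, simplified])

text \<open>The grading rule of \<open>Yexp_nz\<close>, with the parts in \<open>js\<close> adding
  to the conformal weight. A nonzero value of a series forces a nonzero term, so the argument needs
  no convergence.\<close>

lemma modeL_nz:
  assumes "modeL k js b p f (lam, m) \<noteq> 0"
  obtains lam' where "f (lam', m - b) \<noteq> 0"
    "int (wt lam) = int (wt lam') + int (wt (mset js)) - p - 1 - 2 * int k * b * (m - b)"
  using assms
proof (induction js arbitrary: p f lam thesis)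
  case Nil
  then show ?case by (auto elim: Yexp_nz)
next
  case (Cons j js)
  from Cons.prems(2) consider
      (cre) i where "cr i (modeL k js b (p + int i - int j) f) (lam, m) \<noteq> 0"
    | (ann) i where "modeL k js b (p - int i - int j - 1) (hop k (int i) f) (lam, m) \<noteq> 0"
    unfolding modeL_Cons by (metis (no_types, lifting) add_0 mult_zero_right suminf_nz)
  then show thesis
  proof cases
    case cre
    then have i: "i \<in># lam" and nz: "modeL k js b (p + int i - int j) f (lam - {#i#}, m) \<noteq> 0"
      by (auto simp: cr_apply split: if_splits)
    show ?thesis
    proof (rule Cons.IH[OF _ nz])
      fix lam' assume "f (lam', m - b) \<noteq> 0"
        "int (wt (lam - {#i#})) = int (wt lam') + int (wt (mset js)) - (p + int i - int j) - 1
                 - 2 * int k * b * (m - b)"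
      then show thesis
        using Cons.prems(1)[of lam'] wt_remove[OF i] by simp
    qed
  next
    case ann
    show ?thesis
    proof (rule Cons.IH[OF _ ann])
      fix lam' assume "hop k (int i) f (lam', m - b) \<noteq> 0"
        and *: "int (wt lam) = int (wt lam') + int (wt (mset js)) - (p - int i - int j - 1) - 1
                 - 2 * int k * b * (m - b)"
      then obtain lam'' where "f (lam'', m - b) \<noteq> 0" "wt lam'' = i + wt lam'"
        by (auto elim: hop_nz)
      then show thesis
        using Cons.prems(1)[of lam''] * by simp
    qed
  qed
qed

lemma modeL_0_fun: "modeL k js b p (\<lambda>_. 0) = (\<lambda>_. 0)"
proof (rule ext, rule ccontr)
  fix x :: basis assume "modeL k js b p (\<lambda>_. 0) x \<noteq> 0"
  then show False by (cases x) (auto elim: modeL_nz)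
qed

lemma VL_modeL: "f \<in> VL \<Longrightarrow> modeL k js b p f \<in> VL"
proof (rule VL_by_weight[of f _ b
      "\<lambda>x. int (wt (fst x)) + int (wt (mset js)) - p - 1 - 2 * int k * b * snd x"])
  fix lam m assume "modeL k js b p f (lam, m) \<noteq> 0"
  then obtain lam' where "f (lam', m - b) \<noteq> 0"
    "int (wt lam) = int (wt lam') + int (wt (mset js)) - p - 1 - 2 * int k * b * (m - b)"
    by (rule modeL_nz)
  then show "\<exists>x. f x \<noteq> 0 \<and> m = snd x + b \<and>
      int (wt lam) \<le> int (wt (fst x)) + int (wt (mset js)) - p - 1 - 2 * int k * b * snd x"
    by (intro exI[of _ "(lam', m - b)"]) simp
qed

text \<open>Creation terms die because \<open>x\<close> has no part as large as its weight,
  annihilation terms because \<open>f\<close> has bounded weight.\<close>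

lemma modeL_Cons_sum:
  assumes "wt_bound w f" "w \<le> C" "wt (fst x) \<le> C"
  shows "modeL k (j # js) b p f x =
     (\<Sum>i\<le>C. (of_nat i gchoose j) * cr i (modeL k js b (p + int i - int j) f) x)
   + (\<Sum>i\<le>C. ((- of_nat i - 1) gchoose j) * modeL k js b (p - int i - int j - 1) (hop k (int i) f) x)"
  unfolding modeL_Cons using assms
  by (intro arg_cong2[of _ _ _ _ "(+)"] suminf_eq_sum_atMost)
     (auto simp: cr_eq_0 hop_eq_0[OF assms(1)] modeL_0_fun)

lemma cr_modeL_Cons:
  assumes "wt_bound w f" "w \<le> C" "wt (fst x) \<le> C"
  shows "cr i (modeL k (j # js) b p f) x =
     (\<Sum>i'\<le>C. (of_nat i' gchoose j) * cr i (cr i' (modeL k js b (p + int i' - int j) f)) x)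
   + (\<Sum>i'\<le>C. ((- of_nat i' - 1) gchoose j)
         * cr i (modeL k js b (p - int i' - int j - 1) (hop k (int i') f)) x)"
proof -
  have "cr i (modeL k (j # js) b p f) x = cr i (\<lambda>x.
     (\<Sum>i\<le>C. (of_nat i gchoose j) * cr i (modeL k js b (p + int i - int j) f) x)
   + (\<Sum>i\<le>C. ((- of_nat i - 1) gchoose j) * modeL k js b (p - int i - int j - 1) (hop k (int i) f) x)) x"
    using assms by (intro cr_cong modeL_Cons_sum) auto
  then show ?thesis by (simp only: cr_add cr_sum)
qed

text \<open>In a normally ordered product creation operators stand on the left and annihilation
  operators on the right. Each kind commutes with itself, so \<open>T1\<close> and \<open>T4\<close>
  are symmetric in \<open>j\<close> and \<open>j'\<close>, while the two mixed terms
  \<open>T2\<close> are exchanged.\<close>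

lemma modeL_swap:
  assumes f: "wt_bound w f"
  shows "modeL k (j # j' # js) b p f = modeL k (j' # j # js) b p f"
proof
  fix x :: basis
  define C where "C = max w (wt (fst x))"
  have C: "w \<le> C" "wt (fst x) \<le> C" by (auto simp: C_def)
  let ?c = "\<lambda>i j. (of_nat i :: complex) gchoose j" and ?d = "\<lambda>i j. (- of_nat i - 1 :: complex) gchoose j"
  define T1 where "T1 = (\<lambda>j j'. \<Sum>i\<le>C. \<Sum>i'\<le>C. ?c i j * ?c i' j' *
    cr i (cr i' (modeL k js b (p + int i + int i' - int j - int j') f)) x)"
  define T2 where "T2 = (\<lambda>j j'. \<Sum>i\<le>C. \<Sum>i'\<le>C. ?c i j * ?d i' j' *
    cr i (modeL k js b (p + int i - int i' - int j - int j' - 1) (hop k (int i') f)) x)"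
  define T4 where "T4 = (\<lambda>j j'. \<Sum>i\<le>C. \<Sum>i'\<le>C. ?d i j * ?d i' j' *
    modeL k js b (p - int i - int i' - int j - int j' - 2) (hop k (int i') (hop k (int i) f)) x)"
  have expand: "modeL k (j # j' # js) b p f x = T1 j j' + T2 j j' + T2 j' j + T4 j j'" for j j'
  proof -
    have "(\<Sum>i\<le>C. ?c i j * cr i (modeL k (j' # js) b (p + int i - int j) f) x) = T1 j j' + T2 j j'"
      unfolding cr_modeL_Cons[OF f C] T1_def T2_def
      by (simp add: sum_distrib_left distrib_left sum.distrib algebra_simps)
    moreover have "(\<Sum>i\<le>C. ?d i j * modeL k (j' # js) b (p - int i - int j - 1) (hop k (int i) f) x)
        = T2 j' j + T4 j j'"
      unfolding modeL_Cons_sum[OF wt_bound_hop'[OF f] C] T2_def T4_def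
      by (subst sum.swap) (simp add: sum_distrib_left distrib_left sum.distrib algebra_simps)
    ultimately show ?thesis
      unfolding modeL_Cons_sum[OF f C, of k j "j' # js"] by simp
  qed
  have "T1 j j' = T1 j' j"
    unfolding T1_def by (subst sum.swap) (simp add: cr_commute algebra_simps)
  moreover have "T4 j j' = T4 j' j"
    unfolding T4_def by (subst sum.swap) (simp add: hop_commute algebra_simps)
  ultimately show "modeL k (j # j' # js) b p f x = modeL k (j' # j # js) b p f x"
    by (simp only: expand add_ac)
qed

text \<open>\<open>mode_basis\<close> reads the parts in sorted order; this allows a newly created
  part to be treated as the first one.\<close>

lemma modeL_insort:
  assumes "wt_bound w f"
  shows "modeL k (insort j js) b p f = modeL k (j # js) b p f"
  using assms
proof (induction js arbitrary: p f)
  case (Cons a js)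
  have "modeL k (a # insort j js) b p f = modeL k (a # j # js) b p f"
    by (simp only: modeL.simps Cons.IH Cons.prems wt_bound_hop')
  then show ?case
    using modeL_swap[OF Cons.prems] by simp
qed simp


lemma modeL_linear:
  assumes "wt_bound w f" "wt_bound w g"
  shows "modeL k js b p (\<lambda>x. c * f x + g x) = (\<lambda>x. c * modeL k js b p f x + modeL k js b p g x)"
  using assms
proof (induction js arbitrary: p f g)
  case Nil
  then show ?case by (simp add: Yexp_linear)
next
  case (Cons j js)
  show ?case
  proof
    fix x :: basis
    define C where "C = max w (wt (fst x))"
    have C: "w \<le> C" "wt (fst x) \<le> C" by (auto simp: C_def)
    have hop: "hop k (int i) (\<lambda>x. c * f x + g x)
        = (\<lambda>x. c * hop k (int i) f x + hop k (int i) g x)" for i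
      by (auto simp: hop_def algebra_simps)
    show "modeL k (j # js) b p (\<lambda>x. c * f x + g x) x
        = c * modeL k (j # js) b p f x + modeL k (j # js) b p g x"
      unfolding modeL_Cons_sum[OF wt_bound_linear[OF Cons.prems] C] hop Cons.IH[OF Cons.prems]
        Cons.IH[OF Cons.prems[THEN wt_bound_hop']] cr_add cr_smult
        modeL_Cons_sum[OF Cons.prems(1) C] modeL_Cons_sum[OF Cons.prems(2) C]
      by (simp add: sum.distrib sum_distrib_left algebra_simps)
  qed
qed

section \<open>The involution\<close>

lemma theta_apply: "theta f (lam, m) = (-1) ^ size lam * f (lam, - m)"
  by (simp add: theta_def)

lemma theta_theta: "theta (theta f) = f"
  by (auto simp: theta_apply fun_eq_iff simp flip: mult.assoc power_mult_distrib)

lemma theta_linear: "theta (\<lambda>x. c * f x + g x) = (\<lambda>x. c * theta f x + theta g x)"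
  by (auto simp: theta_apply fun_eq_iff algebra_simps)

lemma theta_add: "theta (\<lambda>x. f x + g x) = (\<lambda>x. theta f x + theta g x)"
  using theta_linear[of 1 f g] by simp

lemma theta_smult: "theta (\<lambda>x. c * f x) = (\<lambda>x. c * theta f x)"
  using theta_linear[of c f "\<lambda>_. 0"] by (simp add: theta_def)

lemma theta_0: "theta (\<lambda>_. 0) = (\<lambda>_. 0)"
  by (auto simp: theta_def)

lemma wt_bound_theta: "wt_bound w f \<Longrightarrow> wt_bound w (theta f)"
  unfolding wt_bound_def theta_apply by (metis mult_zero_right)

lemma VL_theta: "f \<in> VL \<Longrightarrow> theta f \<in> VL"
proof -
  assume "f \<in> VL"
  then have "finite ((\<lambda>(lam, m). (lam, - m)) ` {x. f x \<noteq> 0})"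
    by (simp add: VL_def)
  moreover have "{x. theta f x \<noteq> 0} \<subseteq> (\<lambda>(lam, m). (lam, - m)) ` {x. f x \<noteq> 0}"
    by (force simp: theta_apply image_iff)
  ultimately show "theta f \<in> VL"
    unfolding VL_def using finite_subset by blast
qed

lemma theta_cr: "theta (cr i f) x = - cr i (theta f) x"
proof -
  obtain lam m where x: "x = (lam, m)" by fastforce
  show ?thesis
  proof (cases "i \<in># lam")
    case True
    then have "size lam = Suc (size (lam - {#i#}))"
      by (metis size_Suc_Diff1)
    then show ?thesis using True by (simp add: x theta_apply cr_apply)
  qed (simp add: x theta_apply cr_apply)
qed

lemma theta_hop: "theta (hop k (int i) f) = (\<lambda>x. - hop k (int i) (theta f) x)"
proof
  fix x :: basis
  obtain lam m where x: "x = (lam, m)" by fastforce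
  show "theta (hop k (int i) f) x = - hop k (int i) (theta f) x"
    by (rule hop_int_cases[of i]) (auto simp: x theta_apply hop_0 hop_Suc)
qed

lemma prod_minus_1_power_count: "(\<Prod>j\<in>set_mset mu. (-1) ^ count mu j) = (-1 :: complex) ^ size mu"
  by (simp add: size_multiset_overloaded_eq power_sum)

lemma Em_coeff_uminus: "Em_coeff (- b) mu = (-1) ^ size mu * Em_coeff b mu"
proof -
  have "(of_int (- b) / of_nat (j+1)) ^ n / fact n
      = (-1) ^ n * ((of_int b / of_nat (j+1)) ^ n / fact n :: complex)" for j n
    by (simp flip: power_mult_distrib)
  then show ?thesis
    unfolding Em_coeff_def by (simp only: prod.distrib prod_minus_1_power_count)
qed

lemma Ep_coeff_uminus: "Ep_coeff k (- b) lam mu = (-1) ^ size mu * Ep_coeff k b lam mu"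
proof -
  have "(- (2 * of_nat k * of_int (- b))) ^ n * c
      = (-1) ^ n * ((- (2 * of_nat k * of_int b)) ^ n * c :: complex)" for n c
    by (simp flip: power_mult_distrib mult.assoc)
  then show ?thesis
    unfolding Ep_coeff_def by (simp only: prod.distrib prod_minus_1_power_count)
qed

lemma theta_Em: "theta (Em b N f) = Em (- b) N (theta f)"
proof
  fix x :: basis
  obtain lam m where x: "x = (lam, m)" by fastforce
  have "(-1) ^ size lam = (-1) ^ size mu * (-1 :: complex) ^ size (lam - mu)" if "mu \<subseteq># lam" for mu
    using that by (metis size_union subset_mset.add_diff_inverse power_add)
  then show "theta (Em b N f) x = Em (- b) N (theta f) x"
    unfolding x theta_apply Em_apply sum_distrib_left Em_coeff_uminus
    by (intro sum.cong) simp_all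
qed

lemma theta_Ep: "theta (Ep k b M f) = Ep k (- b) M (theta f)"
proof
  fix x :: basis
  obtain lam m where x: "x = (lam, m)" by fastforce
  have "(-1) ^ n * ((-1) ^ n * c) = (c :: complex)" for n c
    by (simp flip: mult.assoc power_mult_distrib)
  then show "theta (Ep k b M f) x = Ep k (- b) M (theta f) x"
    unfolding x theta_apply Ep_apply sum_distrib_left Ep_coeff_uminus
    by (intro sum.cong) (simp_all add: power_add mult.left_commute mult.assoc)
qed

lemma theta_shiftL: "theta (shiftL b f) = shiftL (- b) (theta f)"
  by (auto simp: theta_apply shiftL_apply fun_eq_iff)

lemma theta_Emi: "theta (Emi b N f) = Emi (- b) N (theta f)"
  by (simp add: Emi_def theta_Em theta_0)

text \<open>Reversing the signs of both \<open>b\<close> and the charge leaves the exponent 2kb(m-b)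
  unchanged, so the identity can be checked summand by summand.\<close>

lemma theta_Yexp:
  assumes "wt_bound w f"
  shows "theta (Yexp k b p f) = Yexp k (- b) p (theta f)"
proof
  fix x :: basis
  obtain lam m where x: "x = (lam, m)" by fastforce
  have "theta (Yexp k b p f) (lam, m) = (\<Sum>M\<le>w. theta
      (Emi b (int M - p - 1 - 2 * int k * b * (- m - b)) (shiftL b (Ep k b M f))) (lam, m))"
    by (simp add: theta_apply Yexp_sum[OF assms order_refl] sum_distrib_left)
  also have "\<dots> = Yexp k (- b) p (theta f) (lam, m)"
    by (simp add: theta_Emi theta_shiftL theta_Ep Yexp_sum[OF wt_bound_theta[OF assms] order_refl]
          algebra_simps)
  finally show "theta (Yexp k b p f) x = Yexp k (- b) p (theta f) x"
    by (simp add: x)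
qed

lemma modeL_uminus:
  assumes "wt_bound w f"
  shows "modeL k js b p (\<lambda>x. - f x) = (\<lambda>x. - modeL k js b p f x)"
  using modeL_linear[OF assms, of "\<lambda>_. 0" k js b p "-1"] by (simp add: wt_bound_def modeL_0_fun)

text \<open>Each Heisenberg factor, whether creating or annihilating, anticommutes with
  \<open>theta\<close> and contributes one sign.\<close>

lemma theta_modeL:
  assumes "wt_bound w f"
  shows "theta (modeL k js b p f) x = (-1) ^ length js * modeL k js (- b) p (theta f) x"
  using assms
proof (induction js arbitrary: p f x)
  case Nil
  then show ?case by (simp add: theta_Yexp)
next
  case (Cons j js)
  obtain lam m where x: "x = (lam, m)" by fastforce
  define C where "C = max w (wt lam)"
  \<comment> \<open>\<open>theta\<close> evaluates at charge -m, so the truncation is needed at both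
    charges; it depends on \<open>lam\<close> alone.\<close>
  have C: "w \<le> C" "wt (fst (lam, m)) \<le> C" for m :: int by (auto simp: C_def)
  have ih: "theta (modeL k js b q g) = (\<lambda>x. (-1) ^ length js * modeL k js (- b) q (theta g) x)"
    if "wt_bound w g" for q g
    using Cons.IH[OF that] by blast
  have "theta (modeL k (j # js) b p f) (lam, m) =
      (\<Sum>i\<le>C. (of_nat i gchoose j) * theta (cr i (modeL k js b (p + int i - int j) f)) (lam, m))
    + (\<Sum>i\<le>C. ((- of_nat i - 1) gchoose j)
        * theta (modeL k js b (p - int i - int j - 1) (hop k (int i) f)) (lam, m))"
    by (simp add: theta_apply modeL_Cons_sum[OF Cons.prems C] sum_distrib_left distrib_left
          mult.left_commute del: modeL.simps)
  also have "\<dots> = (-1) ^ length (j # js) * modeL k (j # js) (- b) p (theta f) (lam, m)"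
    by (simp add: theta_cr ih Cons.prems wt_bound_hop' cr_smult theta_hop
          modeL_uminus[OF wt_bound_hop'[OF wt_bound_theta[OF Cons.prems]]]
          modeL_Cons_sum[OF wt_bound_theta[OF Cons.prems] C]
          sum_distrib_left distrib_left sum_negf mult.left_commute del: modeL.simps)
  finally show ?case by (simp only: x)
qed

section \<open>Bilinearity and equivariance of the products\<close>

lemma VL_sum:
  assumes "\<And>a. a \<in> A \<Longrightarrow> g a \<in> VL"
  shows "(\<lambda>x. \<Sum>a\<in>A. g a x) \<in> VL"
  using assms by (induction A rule: infinite_finite_induct) (auto intro: VL_0 VL_add)

lemma vmode_superset:
  assumes "finite A" "{x. v x \<noteq> 0} \<subseteq> A"
  shows "vmode k v p u y = (\<Sum>x\<in>A. v x * mode_basis k x p u y)"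
  unfolding vmode_def using assms by (intro sum.mono_neutral_left) auto

lemma VL_vmode: "u \<in> VL \<Longrightarrow> vmode k v p u \<in> VL"
  unfolding vmode_def mode_basis_def by (intro VL_sum VL_smult VL_modeL)

lemma vmode_linear:
  assumes "v \<in> VL" "v' \<in> VL"
  shows "vmode k (\<lambda>x. c * v x + v' x) p u y = c * vmode k v p u y + vmode k v' p u y"
proof -
  let ?A = "{x. v x \<noteq> 0} \<union> {x. v' x \<noteq> 0}"
  have fin: "finite ?A" using assms by (simp add: VL_def)
  have "{x. c * v x + v' x \<noteq> 0} \<subseteq> ?A" by auto
  then have "vmode k (\<lambda>x. c * v x + v' x) p u y = (\<Sum>x\<in>?A. (c * v x + v' x) * mode_basis k x p u y)"
    by (rule vmode_superset[OF fin])
  moreover have "vmode k v p u y = (\<Sum>x\<in>?A. v x * mode_basis k x p u y)"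
    by (rule vmode_superset[OF fin]) auto
  moreover have "vmode k v' p u y = (\<Sum>x\<in>?A. v' x * mode_basis k x p u y)"
    by (rule vmode_superset[OF fin]) auto
  ultimately show ?thesis
    by (simp add: sum_distrib_left distrib_right sum.distrib mult.assoc)
qed

lemma vmode_add:
  assumes "v \<in> VL" "v' \<in> VL"
  shows "vmode k (\<lambda>x. v x + v' x) p u y = vmode k v p u y + vmode k v' p u y"
  using vmode_linear[OF assms, where c = 1] by simp

lemma vmode_0: "vmode k (\<lambda>_. 0) p u y = 0"
  by (simp add: vmode_def)

lemma vmode_smult:
  assumes "v \<in> VL"
  shows "vmode k (\<lambda>x. c * v x) p u y = c * vmode k v p u y"
  using vmode_linear[OF assms VL_0, of k c] by (simp add: vmode_0)

lemma vmode_sum: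
  assumes "\<And>a. a \<in> A \<Longrightarrow> g a \<in> VL"
  shows "vmode k (\<lambda>x. \<Sum>a\<in>A. g a x) p u y = (\<Sum>a\<in>A. vmode k (g a) p u y)"
  using assms
  by (induction A rule: infinite_finite_induct) (simp_all add: vmode_0 vmode_add VL_sum)

lemma vmode_add_right:
  assumes "u \<in> VL" "u' \<in> VL"
  shows "vmode k v p (\<lambda>x. u x + u' x) y = vmode k v p u y + vmode k v p u' y"
proof -
  obtain w1 w2 where w: "wt_bound w1 u" "wt_bound w2 u'"
    using assms VL_imp_wt_bound by blast
  then have "wt_bound (max w1 w2) u" "wt_bound (max w1 w2) u'"
    using wt_bound_mono by (metis max.cobounded1, metis max.cobounded2)
  from modeL_linear[OF this, where c = 1] show ?thesis
    by (simp add: vmode_def mode_basis_def distrib_left sum.distrib)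
qed

text \<open>\<open>theta\<close> is an automorphism: the sign from \<open>theta_modeL\<close> on a
  basis vector is the sign in \<open>theta v\<close>, and negating charges reindexes the support of
  \<open>v\<close>.\<close>

lemma theta_vmode:
  assumes v: "v \<in> VL" and u: "u \<in> VL"
  shows "theta (vmode k v p u) = vmode k (theta v) p (theta u)"
proof
  fix y :: basis
  obtain lam m where y: "y = (lam, m)" by fastforce
  obtain w where w: "wt_bound w u" using u VL_imp_wt_bound by blast
  let ?A = "{x. v x \<noteq> 0}" and ?s = "\<lambda>(lam, m). (lam, - m) :: basis"
  have fin: "finite ?A" using v by (simp add: VL_def)
  have basis: "theta (mode_basis k (mu, b) p u) y
      = (-1) ^ size mu * mode_basis k (mu, - b) p (theta u) y" for mu b
    using theta_modeL[OF w, of k "sorted_list_of_multiset mu"]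
    by (simp add: mode_basis_def flip: size_mset)
  have "theta (vmode k v p u) y = (\<Sum>x\<in>?A. v x * theta (mode_basis k x p u) y)"
    by (simp add: vmode_def y theta_apply sum_distrib_left mult.left_commute)
  also have "\<dots> = (\<Sum>x\<in>?A. theta v (?s x) * mode_basis k (?s x) p (theta u) y)"
    by (intro sum.cong) (auto simp: basis theta_apply mult_ac)
  also have "\<dots> = (\<Sum>x\<in>?s ` ?A. theta v x * mode_basis k x p (theta u) y)"
    by (rule sum.reindex[unfolded comp_def, symmetric]) (auto simp: inj_on_def)
  also have "\<dots> = vmode k (theta v) p (theta u) y"
    by (rule vmode_superset[symmetric]) (use fin in \<open>force simp: theta_apply image_iff\<close>)+
  finally show "theta (vmode k v p u) y = vmode k (theta v) p (theta u) y" .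
qed

lemma vmode_nz:
  assumes "\<And>lam m. v (lam, m) \<noteq> 0 \<Longrightarrow> m = c" "vmode k v p u (lam, m) \<noteq> 0"
  obtains lam' where "u (lam', m - c) \<noteq> 0"
proof -
  obtain mu b where "v (mu, b) * mode_basis k (mu, b) p u (lam, m) \<noteq> 0"
    using assms(2) unfolding vmode_def by (auto elim!: sum.not_neutral_contains_not_neutral)
  then show thesis
    using assms(1)[of mu b] that by (auto simp: mode_basis_def elim: modeL_nz)
qed

text \<open>The defining recursion of \<open>modeL\<close> carried from sorted lists to arbitrary
  vectors: creation of \<open>j\<close> is injective on basis vectors, and
  \<open>modeL_insort\<close> moves the new part to the front.\<close>

lemma vmode_cr:
  assumes v: "v \<in> VL" and f: "wt_bound w f" and C: "w \<le> C" "wt (fst x) \<le> C"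
  shows "vmode k (cr j v) p f x =
      (\<Sum>i\<le>C. (of_nat i gchoose j) * cr i (vmode k v (p + int i - int j) f) x)
    + (\<Sum>i\<le>C. ((- of_nat i - 1) gchoose j) * vmode k v (p - int i - int j - 1) (hop k (int i) f) x)"
proof -
  let ?A = "{x. v x \<noteq> 0}" and ?s = "\<lambda>(lam, m). (add_mset j lam, m) :: basis"
  have fin: "finite ?A" using v by (simp add: VL_def)
  have sub: "{x. cr j v x \<noteq> 0} \<subseteq> ?s ` ?A"
  proof
    fix x assume "x \<in> {x. cr j v x \<noteq> 0}"
    then obtain lam m where "x = (lam, m)" "j \<in># lam" "v (lam - {#j#}, m) \<noteq> 0"
      by (cases x) (auto simp: cr_apply split: if_splits)
    then show "x \<in> ?s ` ?A" by (auto intro!: image_eqI[of _ _ "(lam - {#j#}, m)"])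
  qed
  have basis: "mode_basis k (?s z) p f x =
      (\<Sum>i\<le>C. (of_nat i gchoose j) * cr i (mode_basis k z (p + int i - int j) f) x)
    + (\<Sum>i\<le>C. ((- of_nat i - 1) gchoose j) * mode_basis k z (p - int i - int j - 1) (hop k (int i) f) x)" for z
    by (cases z) (simp add: mode_basis_def modeL_insort[OF f] modeL_Cons_sum[OF f C] del: modeL.simps)
  have "vmode k (cr j v) p f x = (\<Sum>z\<in>?s ` ?A. cr j v z * mode_basis k z p f x)"
    by (rule vmode_superset[OF _ sub]) (use fin in simp)
  also have "\<dots> = (\<Sum>z\<in>?A. cr j v (?s z) * mode_basis k (?s z) p f x)"
    by (rule sum.reindex[unfolded comp_def]) (auto simp: inj_on_def)
  also have "\<dots> = (\<Sum>z\<in>?A. v z * mode_basis k (?s z) p f x)"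
    by (intro sum.cong) (auto simp: cr_apply)
  also have "\<dots> =
      (\<Sum>i\<le>C. \<Sum>z\<in>?A. v z * ((of_nat i gchoose j) * cr i (mode_basis k z (p + int i - int j) f) x))
    + (\<Sum>i\<le>C. \<Sum>z\<in>?A. v z * (((- of_nat i - 1) gchoose j) * mode_basis k z (p - int i - int j - 1) (hop k (int i) f) x))"
    unfolding basis by (simp only: distrib_left sum.distrib sum_distrib_left sum.swap[of _ "{..C}" ?A])
  finally show ?thesis
    by (simp add: vmode_def cr_sum sum_distrib_left mult.left_commute)
qed

section \<open>Derivatives of the exponential vector\<close>

definition exp_vec :: vec where
  "exp_vec = (\<lambda>x. if x = ({#}, 1) then 1 else 0)"

lemma VL_exp_vec: "exp_vec \<in> VL"
  by (simp add: VL_def exp_vec_def)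

lemma VL_cr: "f \<in> VL \<Longrightarrow> cr i f \<in> VL"
  by (rule VL_by_weight[of f _ 0 "\<lambda>x. int (wt (fst x) + Suc i)"])
     (force simp: cr_apply dest: wt_remove split: if_splits)+

lemma vmode_exp_vec: "vmode k exp_vec p f = Yexp k 1 p f"
  by (auto simp: vmode_def exp_vec_def mode_basis_def fun_eq_iff)

text \<open>\<open>Em 1 q exp_vec\<close> is \<open>L(-1)\<^sup>q e\<^sup>\<alpha> / q!\<close>, so its field is the \<open>q\<close>-th divided derivative of
  \<open>Y(e\<^sup>\<alpha>, z)\<close>.\<close>

lemma vmode_Em_exp_vec:
  assumes "wt_bound w f"
  shows "vmode k (Em 1 q exp_vec) p f x = (of_int (int q - p - 1) gchoose q) * Yexp k 1 (p - int q) f x"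
  using assms
proof (induction q arbitrary: p f x rule: less_induct)
  case (less q)
  note f = less.prems
  show ?case
  proof (cases q)
    case 0
    then show ?thesis by (simp add: Em_0 vmode_exp_vec)
  next
    case (Suc n)
    define C where "C = max w (wt (fst x))"
    have C: "w \<le> C" "wt (fst x) \<le> C" by (auto simp: C_def)
    let ?v = "\<lambda>q. Em 1 q exp_vec"
    have ih: "vmode k (?v (n - j)) r g = (\<lambda>x. (of_int (int (n - j) - r - 1) gchoose (n - j)) * Yexp k 1 (r - int (n - j)) g x)"
      if "j \<le> n" "wt_bound w g" for j r g
      using less.IH[of "n - j" g] that Suc by (simp add: fun_eq_iff)
    \<comment> \<open>The Euler recursion for E^- applied to e^alpha expresses the q-th derivative
      through alpha(-j-1) acting on lower ones, to which the induction hypothesis applies.\<close>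
    have rec: "(\<lambda>x. of_nat q * ?v q x) = (\<lambda>x. \<Sum>j\<le>n. cr j (?v (n - j)) x)"
    proof
      fix y :: basis
      obtain lam m where y: "y = (lam, m)" by fastforce
      let ?D = "max n (wt lam)"
      have "of_nat q * ?v q (lam, m) = (\<Sum>j\<le>?D. cr j (Emi 1 (int q - 1 - int j) exp_vec) (lam, m))"
        using Em_rec[of lam ?D q 1 exp_vec m] by simp
      also have "\<dots> = (\<Sum>j\<le>n. cr j (Emi 1 (int q - 1 - int j) exp_vec) (lam, m))"
        by (rule sum.mono_neutral_right) (auto simp: Suc Emi_def cr_apply)
      also have "\<dots> = (\<Sum>j\<le>n. cr j (?v (n - j)) (lam, m))"
        by (intro sum.cong) (auto simp: Suc Emi_def nat_diff_distrib')
      finally show "of_nat q * ?v q y = (\<Sum>j\<le>n. cr j (?v (n - j)) y)"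
        by (simp only: y)
    qed
    \<comment> \<open>For both kinds of terms the upper entries add up to n - p - 1, whatever
      \<open>i\<close> is. The sums over \<open>j\<close> therefore give one common factor, and what
      remains is the left side of \<open>Yexp_derivative\<close>.\<close>
    have vandermonde: "(\<Sum>j\<le>n. (a gchoose j) * (of_int s gchoose (n - j))) = (of_int t gchoose n)"
      if "a + of_int s = of_int t" for a :: complex and s t
      using gbinomial_Vandermonde[of a "of_int s" n] that by (simp add: atLeast0AtMost)
    let ?r = "p - int n"
    have "of_nat q * vmode k (?v q) p f x = vmode k (\<lambda>x. of_nat q * ?v q x) p f x"
      by (simp add: vmode_smult VL_Em VL_exp_vec)
    also have "\<dots> = (\<Sum>j\<le>n. vmode k (cr j (?v (n - j))) p f x)"
      unfolding rec by (rule vmode_sum) (simp add: VL_cr VL_Em VL_exp_vec)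
    also have "\<dots> = (\<Sum>j\<le>n.
        (\<Sum>i\<le>C. (of_nat i gchoose j) * cr i (vmode k (?v (n - j)) (p + int i - int j) f) x)
      + (\<Sum>i\<le>C. ((- of_nat i - 1) gchoose j) * vmode k (?v (n - j)) (p - int i - int j - 1) (hop k (int i) f) x))"
      by (intro sum.cong refl vmode_cr[OF _ f C] VL_Em VL_exp_vec)
    also have "\<dots> = (\<Sum>j\<le>n.
        (\<Sum>i\<le>C. (of_nat i gchoose j) * (of_int (int n - p - int i - 1) gchoose (n - j))
            * cr i (Yexp k 1 (?r + int i) f) x)
      + (\<Sum>i\<le>C. ((- of_nat i - 1) gchoose j) * (of_int (int n - p + int i) gchoose (n - j))
            * Yexp k 1 (?r - 1 - int i) (hop k (int i) f) x))"
    proof (intro sum.cong refl arg_cong2[of _ _ _ _ "(+)"])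
      fix j i assume "j \<in> {..n}"
      then have j: "j \<le> n" by simp
      have e: "int (n - j) - (p + int i - int j) - 1 = int n - p - int i - 1"
        "p + int i - int j - int (n - j) = ?r + int i"
        "int (n - j) - (p - int i - int j - 1) - 1 = int n - p + int i"
        "p - int i - int j - 1 - int (n - j) = ?r - 1 - int i"
        using j by (auto simp: of_nat_diff)
      show "(of_nat i gchoose j) * cr i (vmode k (?v (n - j)) (p + int i - int j) f) x
          = (of_nat i gchoose j) * (of_int (int n - p - int i - 1) gchoose (n - j))
            * cr i (Yexp k 1 (?r + int i) f) x"
        unfolding ih[OF j f] cr_smult e by (simp only: mult.assoc)
      show "((- of_nat i - 1) gchoose j) * vmode k (?v (n - j)) (p - int i - int j - 1) (hop k (int i) f) x
          = ((- of_nat i - 1) gchoose j) * (of_int (int n - p + int i) gchoose (n - j))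
            * Yexp k 1 (?r - 1 - int i) (hop k (int i) f) x"
        unfolding ih[OF j wt_bound_hop'[OF f]] e by (simp only: mult.assoc)
    qed
    also have "\<dots> =
        (\<Sum>i\<le>C. (\<Sum>j\<le>n. (of_nat i gchoose j) * (of_int (int n - p - int i - 1) gchoose (n - j)))
            * cr i (Yexp k 1 (?r + int i) f) x)
      + (\<Sum>i\<le>C. (\<Sum>j\<le>n. ((- of_nat i - 1) gchoose j) * (of_int (int n - p + int i) gchoose (n - j)))
            * Yexp k 1 (?r - 1 - int i) (hop k (int i) f) x)"
      by (simp only: sum.distrib sum_distrib_right sum.swap[of _ "{..C}" "{..n}"])
    also have "\<dots> =
        (\<Sum>i\<le>C. (of_int (int n - p - 1) gchoose n) * cr i (Yexp k 1 (?r + int i) f) x)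
      + (\<Sum>i\<le>C. (of_int (int n - p - 1) gchoose n) * Yexp k 1 (?r - 1 - int i) (hop k (int i) f) x)"
      by (intro arg_cong2[of _ _ _ _ "(+)"] sum.cong refl arg_cong2[of _ _ _ _ times] vandermonde) simp_all
    also have "\<dots> = (of_int (int n - p - 1) gchoose n) * (- of_int ?r * Yexp k 1 (?r - 1) f x)"
      using Yexp_derivative[OF f C, of 1 k ?r] by (simp only: of_int_1 mult_1 flip: sum_distrib_left distrib_left)
    also have "\<dots> = of_nat q * ((of_int (int q - p - 1) gchoose q) * Yexp k 1 (p - int q) f x)"
    proof -
      have "of_int (int q - p - 1) - 1 = (of_int (int n - p - 1) :: complex)"
        by (simp add: Suc)
      \<comment> \<open>Absorption q binom(a, q) = a binom(a-1, q-1) with a = q - p - 1 = -(p -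
        n).\<close>
      then have "of_nat q * (of_int (int q - p - 1) gchoose q)
          = - of_int ?r * (of_int (int n - p - 1) gchoose n :: complex)"
        using gbinomial_absorption[of n "of_int (int q - p - 1) :: complex"] Suc
        by simp
      moreover have "?r - 1 = p - int q" by (simp add: Suc)
      ultimately show ?thesis
        by (metis mult.assoc mult.left_commute)
    qed
    finally show ?thesis
      using Suc by (simp del: of_nat_Suc)
  qed
qed

section \<open>Decomposition by charge\<close>

definition VLplus_part :: "nat \<Rightarrow> vec set" where
  "VLplus_part n = {f \<in> VLplus. \<forall>lam m. f (lam, m) \<noteq> 0 \<longrightarrow> \<bar>m\<bar> = int n}"

lemma VL_linear: "f \<in> VL \<Longrightarrow> g \<in> VL \<Longrightarrow> (\<lambda>x. c * f x + g x) \<in> VL"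
  by (intro VL_add VL_smult)

lemma VLplus_linear: "f \<in> VLplus \<Longrightarrow> g \<in> VLplus \<Longrightarrow> (\<lambda>x. c * f x + g x) \<in> VLplus"
  by (simp add: VLplus_def VL_linear theta_linear)

lemma VLplus_add: "f \<in> VLplus \<Longrightarrow> g \<in> VLplus \<Longrightarrow> (\<lambda>x. f x + g x) \<in> VLplus"
  using VLplus_linear[of f g 1] by simp

lemma VLplus_0: "(\<lambda>_. 0) \<in> VLplus"
  by (simp add: VLplus_def VL_0 theta_0)

lemma VLplus_part_0_fun: "(\<lambda>_. 0) \<in> VLplus_part n"
  by (simp add: VLplus_part_def VLplus_0)

lemma VLplus_part_linear:
  "f \<in> VLplus_part n \<Longrightarrow> g \<in> VLplus_part n \<Longrightarrow> (\<lambda>x. c * f x + g x) \<in> VLplus_part n"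
  unfolding VLplus_part_def by (auto intro: VLplus_linear) (metis add_0 mult_zero_right)

lemma M1plus_eq: "M1plus = VLplus_part 0"
  unfolding M1plus_def M1_def VLplus_part_def VLplus_def by auto

lemma VL_tens:
  assumes "f \<in> VL"
  shows "tens f m \<in> VL"
proof -
  have "(\<lambda>(lam, l). if l = 0 then f (lam, 0) else 0) \<in> VL"
    by (rule VL_support_le[OF assms]) (auto split: if_splits)
  then show ?thesis
    by (rule VL_by_weight[of _ _ m "\<lambda>x. int (wt (fst x))"]) (auto simp: tens_def split: if_splits)
qed

text \<open>Invariance under \<open>theta\<close> determines charge -1 from charge 1. On
  \<open>M1\<close> the involution is (-1)^size, so separating even from odd partition length gives
  the two tensor factors.\<close>

lemma VLplus1_eq: "VLplus1 = VLplus_part 1"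
proof (intro equalityI subsetI)
  fix f assume "f \<in> VLplus1"
  then obtain p q where p: "p \<in> M1plus" and q: "q \<in> M1minus"
    and f: "f = (\<lambda>x. tens p 1 x + tens p (-1) x + tens q 1 x - tens q (-1) x)"
    by (auto simp: VLplus1_def)
  have "p \<in> VL" "q \<in> VL"
    using p q by (auto simp: M1plus_def M1minus_def M1_def)
  then have "(\<lambda>x. tens p 1 x + tens p (-1) x + tens q 1 x + (-1) * tens q (-1) x) \<in> VL"
    by (intro VL_add VL_smult VL_tens)
  then have "f \<in> VL" by (simp add: f)
  have tp: "(-1) ^ size lam * p (lam, 0) = p (lam, 0)" for lam
    using p theta_apply[of p lam 0] by (simp add: M1plus_def)
  have tq: "(-1) ^ size lam * q (lam, 0) = - q (lam, 0)" for lam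
    using q theta_apply[of q lam 0] by (simp add: M1minus_def)
  have "theta f x = f x" for x
    by (cases x) (auto simp: f theta_apply tens_def distrib_left right_diff_distrib tp tq)
  moreover have "f (lam, m) \<noteq> 0 \<Longrightarrow> \<bar>m\<bar> = 1" for lam m
    by (auto simp: f tens_def split: if_splits)
  ultimately show "f \<in> VLplus_part 1"
    using \<open>f \<in> VL\<close> by (auto simp: VLplus_part_def VLplus_def)
next
  fix f assume "f \<in> VLplus_part 1"
  then have f: "f \<in> VL" "theta f = f" and supp: "\<And>lam m. f (lam, m) \<noteq> 0 \<Longrightarrow> \<bar>m\<bar> = 1"
    by (auto simp: VLplus_part_def VLplus_def)
  define r where "r = (\<lambda>P (lam, m :: int). if m = 0 \<and> P (size lam) then f (lam, 1) else 0)"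
  have "r P \<in> VL" for P
    by (rule VL_by_weight[OF f(1), of _ "-1" "\<lambda>x. int (wt (fst x))"])
       (auto simp: r_def split: if_splits intro!: exI[of _ 1])
  then have M1: "r P \<in> M1" for P
    by (simp add: M1_def r_def)
  have "r even \<in> M1plus" "r odd \<in> M1minus"
    using M1 by (auto simp: M1plus_def M1minus_def r_def theta_apply fun_eq_iff)
  moreover have "f = (\<lambda>x. tens (r even) 1 x + tens (r even) (-1) x + tens (r odd) 1 x - tens (r odd) (-1) x)"
  proof
    fix x :: basis
    obtain lam m where x: "x = (lam, m)" by fastforce
    have "f (lam, - 1) = (-1) ^ size lam * f (lam, 1)"
      using theta_apply[of f lam "-1"] f(2) by simp
    moreover have "f (lam, m) = 0" if "m \<noteq> 1" "m \<noteq> - 1"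
      using supp[of lam m] that by linarith
    ultimately show "f x = tens (r even) 1 x + tens (r even) (-1) x + tens (r odd) 1 x - tens (r odd) (-1) x"
      by (auto simp: x tens_def r_def)
  qed
  ultimately show "f \<in> VLplus1"
    unfolding VLplus1_def by blast
qed

text \<open>Invariant vectors of nonzero charge are recovered from their positive charge half, so
  the calculations below can stay in positive charge.\<close>

definition symmetrize :: "vec \<Rightarrow> vec" where
  "symmetrize f = (\<lambda>x. f x + theta f x)"

lemma symmetrize_smult: "symmetrize (\<lambda>x. c * f x) = (\<lambda>x. c * symmetrize f x)"
  by (simp add: symmetrize_def theta_smult distrib_left)

lemma symmetrize_VLplus: "f \<in> VL \<Longrightarrow> symmetrize f \<in> VLplus"
  by (simp add: symmetrize_def VLplus_def VL_add VL_theta theta_add theta_theta add.commute)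

lemma symmetrize_VLplus_part:
  assumes "f \<in> VL" "\<And>lam m. f (lam, m) \<noteq> 0 \<Longrightarrow> m = int n"
  shows "symmetrize f \<in> VLplus_part n"
proof -
  have "\<bar>m\<bar> = int n" if "symmetrize f (lam, m) \<noteq> 0" for lam m
  proof -
    have "f (lam, m) \<noteq> 0 \<or> f (lam, - m) \<noteq> 0"
      using that by (auto simp: symmetrize_def theta_apply)
    then show ?thesis using assms(2) by force
  qed
  then show ?thesis using symmetrize_VLplus[OF assms(1)] by (auto simp: VLplus_part_def)
qed

section \<open>The spanning statement\<close>

definition spanned :: "nat \<Rightarrow> vec set" where
  "spanned k = {(\<lambda>x. a x + b x + c x) | a b c.
                  a \<in> M1plus \<and> b \<in> VLplus1 \<and> c \<in> C2 k VLplus}"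

lemma C2_linear: "f \<in> C2 k V \<Longrightarrow> g \<in> C2 k V \<Longrightarrow> (\<lambda>x. c * f x + g x) \<in> C2 k V"
  unfolding C2_def by (intro cspan.add cspan.smult)

lemma spannedI:
  assumes "a \<in> VLplus_part 0" "b \<in> VLplus_part 1" "c \<in> C2 k VLplus"
    and "\<And>x. f x = a x + b x + c x"
  shows "f \<in> spanned k"
proof -
  have "f = (\<lambda>x. a x + b x + c x)" using assms(4) by (rule ext)
  then show ?thesis
    unfolding spanned_def M1plus_eq VLplus1_eq using assms(1-3) by blast
qed

lemma spannedE:
  assumes "f \<in> spanned k"
  obtains a b c where "a \<in> VLplus_part 0" "b \<in> VLplus_part 1" "c \<in> C2 k VLplus"
    "f = (\<lambda>x. a x + b x + c x)"
  using assms unfolding spanned_def M1plus_eq VLplus1_eq by blast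

lemma spanned_linear:
  assumes "f \<in> spanned k" "g \<in> spanned k"
  shows "(\<lambda>x. z * f x + g x) \<in> spanned k"
proof -
  obtain a b c a' b' c' where *: "a \<in> VLplus_part 0" "b \<in> VLplus_part 1" "c \<in> C2 k VLplus"
    "f = (\<lambda>x. a x + b x + c x)" "a' \<in> VLplus_part 0" "b' \<in> VLplus_part 1" "c' \<in> C2 k VLplus"
    "g = (\<lambda>x. a' x + b' x + c' x)"
    using assms by (elim spannedE)
  show ?thesis
    by (rule spannedI[OF VLplus_part_linear[where c = z, OF *(1,5)]
        VLplus_part_linear[where c = z, OF *(2,6)] C2_linear[where c = z, OF *(3,7)]])
       (simp add: * algebra_simps)
qed

lemma C2_0: "(\<lambda>_. 0) \<in> C2 k V"
  unfolding C2_def by (rule cspan.zero)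

lemma C2_subset_spanned: "C2 k VLplus \<subseteq> spanned k"
  by (auto intro: spannedI[OF VLplus_part_0_fun VLplus_part_0_fun])

lemma VLplus_part_0_subset: "VLplus_part 0 \<subseteq> spanned k"
  by (auto intro: spannedI[OF _ VLplus_part_0_fun C2_0])

lemma VLplus_part_1_subset: "VLplus_part 1 \<subseteq> spanned k"
  by (auto intro: spannedI[OF VLplus_part_0_fun _ C2_0])

lemma spanned_0: "(\<lambda>_. 0) \<in> spanned k"
  using VLplus_part_0_subset VLplus_part_0_fun by blast

lemma spanned_smult: "f \<in> spanned k \<Longrightarrow> (\<lambda>x. c * f x) \<in> spanned k"
  using spanned_linear[OF _ spanned_0] by fastforce

lemma spanned_diff: "f \<in> spanned k \<Longrightarrow> g \<in> spanned k \<Longrightarrow> (\<lambda>x. f x - g x) \<in> spanned k"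
  using spanned_linear[of g k f "-1"] by simp

lemma spanned_sum:
  assumes "\<And>a. a \<in> A \<Longrightarrow> g a \<in> spanned k"
  shows "(\<lambda>x. \<Sum>a\<in>A. g a x) \<in> spanned k"
  using assms
proof (induction A rule: infinite_finite_induct)
  case (insert a A)
  then show ?case using spanned_linear[of "g a" k "\<lambda>x. \<Sum>a\<in>A. g a x" 1] by simp
qed (simp_all add: spanned_0)

text \<open>The fixed points are closed under all products because \<open>theta\<close> is an
  automorphism; this gives the easy inclusion of the theorem.\<close>

lemma C2_subset_VLplus: "C2 k VLplus \<subseteq> VLplus"
proof
  fix f assume "f \<in> C2 k VLplus"
  then show "f \<in> VLplus"
    unfolding C2_def
  proof induction
    case (base x)
    then obtain v u where "x = vmode k v (-2) u" "v \<in> VLplus" "u \<in> VLplus" by blast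
    then show ?case by (simp add: VLplus_def VL_vmode theta_vmode)
  next
    case (smult x c)
    then show ?case using VLplus_linear[OF _ VLplus_0] by fastforce
  qed (simp_all add: VLplus_0 VLplus_add)
qed

section \<open>Climbing from charge n to charge n + 2\<close>

text \<open>Multiplying by the symmetrized derivative of e^alpha reaches charges n + 2 and n. The
  product lies in C_2 and its charge n part is covered by \<open>low\<close>.\<close>

lemma symmetrize_Yexp_spanned:
  assumes low: "VLplus_part n \<subseteq> spanned k"
    and b: "b \<in> VL" "\<And>lam m. b (lam, m) \<noteq> 0 \<Longrightarrow> m = int (Suc n)"
  shows "symmetrize (Yexp k 1 (- 2 - int q) b) \<in> spanned k"
proof -
  let ?v = "Em 1 q exp_vec"
  have v: "?v \<in> VL" by (intro VL_Em VL_exp_vec)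
  have v1: "m = 1" if "?v (lam, m) \<noteq> 0" for lam m
    using that by (auto elim!: Em_nz simp: exp_vec_def split: if_splits)
  have v1': "m = - 1" if "theta ?v (lam, m) \<noteq> 0" for lam m
    using v1[of lam "- m"] that by (simp add: theta_apply)
  define h where "h = vmode k (theta ?v) (-2) b"
  have "symmetrize h \<in> spanned k"
  proof (rule subsetD[OF low], rule symmetrize_VLplus_part)
    show "h \<in> VL" unfolding h_def by (rule VL_vmode[OF b(1)])
    fix lam m assume nz: "h (lam, m) \<noteq> 0"
    obtain lam' where "b (lam', m - (- 1)) \<noteq> 0"
      by (rule vmode_nz[OF v1' nz[unfolded h_def]])
    then show "m = int n" using b(2)[of lam' "m - (- 1)"] by simp
  qed
  moreover have "vmode k (symmetrize ?v) (-2) (symmetrize b) \<in> C2 k VLplus"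
    unfolding C2_def using symmetrize_VLplus[OF v] symmetrize_VLplus[OF b(1)] by (intro cspan.base) blast
  then have "vmode k (symmetrize ?v) (-2) (symmetrize b) \<in> spanned k"
    using C2_subset_spanned by blast
  \<comment> \<open>Of the four products, \<open>theta\<close> pairs v_(-2) b with (theta v)_(-2)
    (theta b), and \<open>h\<close> with v_(-2) (theta b).\<close>
  moreover have "vmode k (symmetrize ?v) (-2) (symmetrize b) x - symmetrize h x = symmetrize (vmode k ?v (-2) b) x" for x
    using v b(1)
    by (simp add: symmetrize_def[of ?v] symmetrize_def[of b] vmode_add vmode_add_right VL_theta VL_add h_def
        symmetrize_def[of "vmode k _ _ _"] theta_vmode theta_theta)
  ultimately have "symmetrize (vmode k ?v (-2) b) \<in> spanned k"
    using spanned_diff[of "vmode k (symmetrize ?v) (-2) (symmetrize b)" k "symmetrize h"] by simp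
  moreover obtain w where "wt_bound w b"
    using b(1) VL_imp_wt_bound by blast
  then have "vmode k ?v (-2) b = (\<lambda>x. of_nat (Suc q) * Yexp k 1 (- 2 - int q) b x)"
  proof (intro ext)
    fix x
    \<comment> \<open>The factor relating the two modes is binom(q+1, q) = q + 1, which is nonzero
      and can be divided out at the end.\<close>
    have "(of_int (int q - (-2) - 1) gchoose q :: complex) = of_nat (Suc q) gchoose q"
      by (simp add: add.commute)
    also have "\<dots> = of_nat (Suc q choose q)"
      by (simp only: binomial_gbinomial)
    also have "\<dots> = of_nat (Suc q)" by simp
    finally show "vmode k ?v (-2) b x = of_nat (Suc q) * Yexp k 1 (- 2 - int q) b x"
      using vmode_Em_exp_vec[OF \<open>wt_bound w b\<close>, of k q "-2" x] by simp
  qed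
  ultimately have "(\<lambda>x. of_nat (Suc q) * symmetrize (Yexp k 1 (- 2 - int q) b) x) \<in> spanned k"
    by (simp only: symmetrize_smult)
  from spanned_smult[OF this, of "inverse (of_nat (Suc q))"] show ?thesis
    by (simp del: of_nat_Suc flip: mult.assoc)
qed

text \<open>The index \<open>r\<close> must stay free in the induction: the correction coming from
  E^+ of degree \<open>M\<close> carries E^- of degree \<open>M + r\<close>. A bound
  \<open>w\<close> replaces an exact weight because \<open>b\<close> need not be
  homogeneous.\<close>

lemma symmetrize_Em_spanned:
  assumes low: "VLplus_part n \<subseteq> spanned k" and k: "k > 0"
    and b: "b \<in> VL" "\<And>lam m. b (lam, m) \<noteq> 0 \<Longrightarrow> m = int (Suc n)" "wt_bound w b"
  shows "symmetrize (Em 1 r (shiftL 1 b)) \<in> spanned k"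
  using b
proof (induction w arbitrary: b r rule: less_induct)
  case (less w)
  note b = less.prems
  let ?t = "\<lambda>M. Em 1 (M + r) (shiftL 1 (Ep k 1 M b))"
  \<comment> \<open>Chosen so that on charge n + 1 the E^- exponent becomes \<open>M + r\<close>;
    positivity of \<open>k\<close> keeps the natural subtraction exact.\<close>
  define q where "q = 2 * k * Suc n + r - 1"
  have "2 * k * Suc n + r \<ge> 1" using k by simp
  then have q: "- 2 - int q = - 1 - 2 * int k * int (Suc n) - int r"
    unfolding q_def by (simp add: of_nat_diff algebra_simps)
  have "Yexp k 1 (- 2 - int q) b x = (\<Sum>M\<le>w. ?t M x)" for x
  proof -
    obtain lam m where x: "x = (lam, m)" by fastforce
    show ?thesis
    proof (cases "m - 1 = int (Suc n)")
      case True
      have "int M - (- 2 - int q) - 1 - 2 * int k * 1 * (m - 1) = int (M + r)" for M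
        unfolding True q by simp
      then show ?thesis
        by (simp only: x Yexp_sum[OF b(3) order_refl] Emi_of_nat)
    next
      case False
      have "?t M (lam, m) = 0" for M
      proof (rule ccontr)
        assume "?t M (lam, m) \<noteq> 0"
        then obtain mu where "Ep k 1 M b (mu, m - 1) \<noteq> 0"
          by (auto elim!: Em_nz simp: shiftL_apply)
        then show False using False by (auto elim!: Ep_nz dest!: b(2))
      qed
      moreover have "Yexp k 1 (- 2 - int q) b (lam, m) = 0"
        using False by (rule_tac ccontr) (auto elim!: Yexp_nz dest!: b(2))
      ultimately show ?thesis by (simp add: x)
    qed
  qed
  \<comment> \<open>The summand \<open>M = 0\<close> is the vector sought, since \<open>Ep\<close>
    of degree 0 is the identity; all others have a strictly smaller weight bound.\<close>
  then have Y: "Yexp k 1 (- 2 - int q) b x = Em 1 r (shiftL 1 b) x + (\<Sum>i<w. ?t (Suc i) x)" for x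
    by (simp add: sum.atMost_shift Ep_0)
  have "symmetrize (?t (Suc i)) \<in> spanned k" if "i < w" for i
  proof (rule less.IH)
    show "w - Suc i < w" using that by simp
    show "wt_bound (w - Suc i) (Ep k 1 (Suc i) b)" by (rule wt_bound_Ep[OF b(3)])
    show "Ep k 1 (Suc i) b \<in> VL" by (rule VL_Ep[OF b(1)])
    show "m = int (Suc n)" if "Ep k 1 (Suc i) b (lam, m) \<noteq> 0" for lam m
      using that b(2) by (auto elim!: Ep_nz)
  qed
  then have "(\<lambda>x. \<Sum>i<w. symmetrize (?t (Suc i)) x) \<in> spanned k"
    by (intro spanned_sum) simp
  from spanned_diff[OF symmetrize_Yexp_spanned[OF low b(1,2)] this]
  have "(\<lambda>x. symmetrize (Yexp k 1 (- 2 - int q) b) x - (\<Sum>i<w. symmetrize (?t (Suc i)) x)) \<in> spanned k" .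
  also have "(\<lambda>x. symmetrize (Yexp k 1 (- 2 - int q) b) x - (\<Sum>i<w. symmetrize (?t (Suc i)) x))
      = symmetrize (Em 1 r (shiftL 1 b))"
  proof
    fix x
    show "symmetrize (Yexp k 1 (- 2 - int q) b) x - (\<Sum>i<w. symmetrize (?t (Suc i)) x) = symmetrize (Em 1 r (shiftL 1 b)) x"
      by (cases x) (simp add: symmetrize_def theta_apply Y sum.distrib sum_distrib_left distrib_left)
  qed
  finally show ?case .
qed

lemma VLplus_part_subset_spanned:
  assumes "k > 0"
  shows "VLplus_part n \<subseteq> spanned k"
proof (induction n rule: less_induct)
  case (less n)
  consider "n = 0" | "n = 1" | n' where "n = Suc (Suc n')"
    by (cases n rule: nat.exhaust; cases "n - 1" rule: nat.exhaust) auto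
  then show ?case
  proof cases
    case 3
    show ?thesis
    proof
      fix f assume "f \<in> VLplus_part n"
      then have f: "f \<in> VL" "theta f = f" and supp: "\<And>lam m. f (lam, m) \<noteq> 0 \<Longrightarrow> \<bar>m\<bar> = int n"
        by (auto simp: VLplus_part_def VLplus_def)
      \<comment> \<open>The positive charge half of \<open>f\<close>, moved down to charge n - 1, so
        that \<open>shiftL 1\<close> restores it; \<open>Em\<close> of degree 0 is then the
        identity.\<close>
      define b where "b = (\<lambda>(lam, m). if m = int (Suc n') then f (lam, int n) else 0)"
      have b: "b \<in> VL"
      proof (rule VL_by_weight[OF f(1), of _ "-1" "\<lambda>x. int (wt (fst x))"])
        fix lam m assume "b (lam, m) \<noteq> 0"
        then show "\<exists>x. f x \<noteq> 0 \<and> m = snd x + - 1 \<and> int (wt lam) \<le> int (wt (fst x))"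
          by (intro exI[of _ "(lam, int n)"]) (simp add: b_def 3 split: if_splits)
      qed
      then obtain w where w: "wt_bound w b"
        using VL_imp_wt_bound by blast
      have "symmetrize (Em 1 0 (shiftL 1 b)) \<in> spanned k"
      proof (rule symmetrize_Em_spanned[OF _ assms b _ w])
        show "VLplus_part n' \<subseteq> spanned k"
          by (rule less.IH) (simp add: 3)
        show "m = int (Suc n')" if "b (lam, m) \<noteq> 0" for lam m
          using that by (simp add: b_def split: if_splits)
      qed
      moreover have "symmetrize (Em 1 0 (shiftL 1 b)) = f"
      proof
        fix x :: basis
        obtain lam m where x: "x = (lam, m)" by fastforce
        have val: "symmetrize (Em 1 0 (shiftL 1 b)) x
            = (if m = int n then f (lam, int n) else 0)
              + (-1) ^ size lam * (if m = - int n then f (lam, int n) else 0)"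
          by (auto simp: x symmetrize_def Em_0 theta_apply shiftL_apply b_def 3)
        \<comment> \<open>This makes the charges n and -n distinct, so the two halves do not
          overlap.\<close>
        have "n > 0" by (simp add: 3)
        consider "m = int n" | "m = - int n" | "m \<noteq> int n" "m \<noteq> - int n"
          by blast
        then show "symmetrize (Em 1 0 (shiftL 1 b)) x = f x"
        proof cases
          case 1
          then show ?thesis
            using \<open>n > 0\<close> unfolding val by (simp add: x)
        next
          case 2
          then show ?thesis
            using theta_apply[of f lam "- int n"] f(2) \<open>n > 0\<close> unfolding val by (simp add: x)
        next
          case 3
          then show ?thesis
            using supp[of lam m] unfolding val by (cases "f (lam, m) = 0") (auto simp: x)
        qed
      qed
      ultimately show "f \<in> spanned k" by simp
    qed
  qed (use VLplus_part_0_subset VLplus_part_1_subset in auto)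
qed

lemma VLplus_subset_spanned:
  assumes "k > 0"
  shows "VLplus \<subseteq> spanned k"
proof
  fix f assume f: "f \<in> VLplus"
  \<comment> \<open>Finite support leaves finitely many absolute charges, and \<open>f\<close> is
    the sum of its components \<open>?g n\<close>.\<close>
  let ?N = "(\<lambda>x. nat \<bar>snd x\<bar>) ` {x. f x \<noteq> 0}"
  let ?g = "\<lambda>n x. if n = nat \<bar>snd x\<bar> then f x else 0"
  have "?g n \<in> VLplus_part n" for n
  proof -
    have "f \<in> VL" and th: "theta f = f" using f by (auto simp: VLplus_def)
    have "?g n \<in> VL"
      by (intro VL_support_le[OF \<open>f \<in> VL\<close>]) (auto split: if_splits)
    moreover have "theta (?g n) = ?g n"
    proof
      fix x
      show "theta (?g n) x = ?g n x"
        using fun_cong[OF th, of x] by (cases x) (simp add: theta_apply)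
    qed
    ultimately show ?thesis
      by (simp add: VLplus_part_def VLplus_def)
  qed
  then have "(\<lambda>x. \<Sum>n\<in>?N. ?g n x) \<in> spanned k"
    using VLplus_part_subset_spanned[OF assms] by (intro spanned_sum) blast
  moreover have "(\<Sum>n\<in>?N. ?g n x) = f x" for x
  proof -
    have "finite ?N" using f by (simp add: VLplus_def VL_def)
    then have "(\<Sum>n\<in>?N. ?g n x) = (if nat \<bar>snd x\<bar> \<in> ?N then f x else 0)"
      by (rule sum.delta)
    then show ?thesis by fastforce
  qed
  ultimately show "f \<in> spanned k" by simp
qed

theorem theorem4p8:
  fixes k :: nat
  assumes "k \<ge> 3"
  shows "VLplus = {(\<lambda>x. a x + b x + c x) | a b c.
                     a \<in> M1plus \<and> b \<in> VLplus1 \<and> c \<in> C2 k VLplus}"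
proof -
  have "spanned k \<subseteq> VLplus"
  proof
    fix f assume "f \<in> spanned k"
    then obtain a b c where *: "a \<in> VLplus_part 0" "b \<in> VLplus_part 1" "c \<in> C2 k VLplus"
      and f: "f = (\<lambda>x. a x + b x + c x)"
      by (rule spannedE)
    then have "a \<in> VLplus" "b \<in> VLplus" "c \<in> VLplus"
      using C2_subset_VLplus by (auto simp: VLplus_part_def)
    then have "(\<lambda>x. a x + b x + c x) \<in> VLplus"
      by (intro VLplus_add)
    then show "f \<in> VLplus"
      by (simp only: f)
  qed
  moreover have "VLplus \<subseteq> spanned k"
    using assms by (intro VLplus_subset_spanned) simp
  ultimately show ?thesis
    unfolding spanned_def by blast
qed

end
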